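(* Let $\gamma\in(0,1)$, $s=\frac n2+\gamma$ with $\frac n2<s<n$, and $a=1-2\gamma$. Suppose $v_s$ is a positive solution to the PDE $-\Delta_+v_s-s(n-s)v_s=0$ on $\mathbb R^{n+1}_+$. Define $w_s=1-\frac{v_s}{y^{n-s}}$, $\rho_s=v_s^{1/(n-s)}$ and $g_s^*=\rho_s^2g_+$. Assume the following conditions: (1) $w_s\in\tilde H^{1,a}(\mathbb R^{n+1}_+)$. (2) $|\nabla_s^*\rho_s|\le1$. This is equivalent to $\mathrm{sgn}(R_s^* )=\mathrm{sgn}(\gamma-\frac12)$. Then $v_s=y^{n-s}$, or equivalently, $g_s^*\equiv|dz|^2$.
   Context: $\mathbb R^{n+1}_+=\{z=(x,y):x\in\mathbb R^n,\ y>0\}$, $\mathbb R^n$ is identified with $\{y=0\}$, $g_+=y^{-2}|dz|^2$ is the hyperbolic metric, and $\Delta_+$ is its Laplace–Beltrami operator (so $-\Delta_+\ge0$). $\nabla_s^*$ and $R_s^*$ are the covariant derivative and the scalar curvature of $g_s^*=\rho_s^2g_+$, and $|\nabla_s^*\rho_s|$ is measured with respect to $g_s^*$; thus $|\nabla_s^*\rho_s|=\frac{y}{\rho_s}|\nabla\rho_s|$ with the Euclidean gradient on the right. The two quantities in (2) are related by the identity $R_s^*=2n\left(s-\frac{n+1}2\right)\frac{1-|\nabla_s^*\rho_s|^2}{\rho_s^2}$. Weighted Sobolev spaces: $B_r^+=\{z\in\mathbb R^{n+1}_+:|z|<r\}$. For $a\in\mathbb R$, $H^{1,a}(\mathbb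 R^{n+1}_+)$ is the set of $u\in W^{1,1}_{\mathrm{loc}}(\mathbb R^{n+1}_+)$ with $\int_{B_r^+}(|\nabla u|^2+u^2)y^a\,dz<\infty$ for every $r>0$. $\tilde H^{1,a}(\mathbb R^{n+1}_+)$ is the set of $u\in H^{1,a}(\mathbb R^{n+1}_+)$ such that for every $r>0$ there is a sequence $\phi_k\in C^1_c(\overline{B_r^+}\setminus\mathbb R^n)$ with $\int_{B_r^+}(|\nabla(u-\phi_k)|^2+|u-\phi_k|^2)y^a\,dz\to0$.
   Formalization: The remark that |∇ρ_s|≤1 is equivalent to sgn(R_s^* )=sgn(γ-1/2) is false as written (v_s=y^{n-s} has R_s^*=0; for γ=1/2 R_s^* always vanishes), so it is stated for γ≠1/2 with R_s^*=0 also allowed. *)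

theory Defs
  imports "HOL-Analysis.Analysis"
begin

section \<open>Functions of class \<open>C\<^sup>k\<close>\<close>

definition partial_deriv :: "'a::euclidean_space \<Rightarrow> ('a \<Rightarrow> real) \<Rightarrow> 'a \<Rightarrow> real" where
  "partial_deriv b f z = frechet_derivative f (at z) b"

text \<open>Intended for open \<open>S\<close>.\<close>

primrec Ck_on :: "nat \<Rightarrow> ('a::euclidean_space \<Rightarrow> real) \<Rightarrow> 'a set \<Rightarrow> bool" where
  "Ck_on 0 f S \<longleftrightarrow> continuous_on S f"
| "Ck_on (Suc k) f S \<longleftrightarrow>
     (\<forall>z\<in>S. f differentiable (at z)) \<and> (\<forall>b\<in>Basis. Ck_on k (partial_deriv b f) S)"

text \<open>\<open>C\<^sup>1\<close> functions with compact support in \<open>A\<close>. The set \<open>A\<close> need not be open, in which case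
  \<open>C\<^sup>1\<close> on \<open>A\<close> means \<open>C\<^sup>1\<close> on an open neighbourhood of \<open>A\<close>, and the support may meet the part of
  the boundary that belongs to \<open>A\<close>. Values outside \<open>A\<close> are irrelevant.\<close>

definition C1c :: "'a::euclidean_space set \<Rightarrow> ('a \<Rightarrow> real) set" where
  "C1c A = {\<phi>. (\<exists>U. open U \<and> A \<subseteq> U \<and> Ck_on 1 \<phi> U) \<and>
                (\<exists>K. compact K \<and> K \<subseteq> A \<and> (\<forall>z\<in>A - K. \<phi> z = 0))}"


section \<open>Riemannian metrics in a global chart\<close>

type_synonym 'a metric = "'a \<Rightarrow> 'a \<Rightarrow> 'a \<Rightarrow> real"

definition sharp :: "'a::euclidean_space metric \<Rightarrow> 'a \<Rightarrow> ('a \<Rightarrow> real) \<Rightarrow> 'a" where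
  "sharp g z \<alpha> = (THE v. \<forall>w. g z v w = \<alpha> w)"

definition grad :: "'a::euclidean_space metric \<Rightarrow> ('a \<Rightarrow> real) \<Rightarrow> 'a \<Rightarrow> 'a" where
  "grad g u z = sharp g z (frechet_derivative u (at z))"

definition metric_norm :: "'a::euclidean_space metric \<Rightarrow> 'a \<Rightarrow> 'a \<Rightarrow> real" where
  "metric_norm g z v = sqrt (g z v v)"

text \<open>The determinant of the matrix \<open>g\<^sub>i\<^sub>j\<close>, by the Leibniz formula; the library determinant is
  only available for matrices over \<open>real ^ 'n\<close>.\<close>

definition gram_det :: "'a::euclidean_space metric \<Rightarrow> 'a \<Rightarrow> real" where
  "gram_det g z = (\<Sum>p | p permutes Basis. of_int (sign p) * (\<Prod>b\<in>Basis. g z b (p b)))"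

definition laplace_beltrami :: "'a::euclidean_space metric \<Rightarrow> ('a \<Rightarrow> real) \<Rightarrow> 'a \<Rightarrow> real" where
  "laplace_beltrami g u z =
     (\<Sum>b\<in>Basis. partial_deriv b (\<lambda>q. sqrt (gram_det g q) * (grad g u q \<bullet> b)) z)
       / sqrt (gram_det g z)"

text \<open>The entries \<open>g\<^sup>i\<^sup>j\<close> of the inverse matrix.\<close>

definition inv_metric :: "'a::euclidean_space metric \<Rightarrow> 'a \<Rightarrow> 'a \<Rightarrow> 'a \<Rightarrow> real" where
  "inv_metric g z i j = sharp g z (\<lambda>w. w \<bullet> i) \<bullet> j"

text \<open>\<open>christoffel g k i j\<close> has the upper index \<open>k\<close> and the lower indices \<open>i\<close>, \<open>j\<close>.\<close>

definition christoffel :: "'a::euclidean_space metric \<Rightarrow> 'a \<Rightarrow> 'a \<Rightarrow> 'a \<Rightarrow> 'a \<Rightarrow> real" where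
  "christoffel g k i j z = (1/2) * (\<Sum>l\<in>Basis. inv_metric g z k l *
     (partial_deriv i (\<lambda>q. g q j l) z + partial_deriv j (\<lambda>q. g q i l) z
       - partial_deriv l (\<lambda>q. g q i j) z))"

definition ricci :: "'a::euclidean_space metric \<Rightarrow> 'a \<Rightarrow> 'a \<Rightarrow> 'a \<Rightarrow> real" where
  "ricci g j k z = (\<Sum>i\<in>Basis.
      partial_deriv i (christoffel g i j k) z - partial_deriv j (christoffel g i i k) z
      + (\<Sum>p\<in>Basis. christoffel g i i p z * christoffel g p j k z
                   - christoffel g i j p z * christoffel g p i k z))"

definition scalar_curvature :: "'a::euclidean_space metric \<Rightarrow> 'a \<Rightarrow> real" where
  "scalar_curvature g z = (\<Sum>j\<in>Basis. \<Sum>k\<in>Basis. inv_metric g z j k * ricci g j k z)"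


section \<open>The half-space\<close>

text \<open>A point of the half-space is \<open>z = (x, y)\<close> with \<open>y = snd z\<close>; the norm on the product type
  is the Euclidean one.\<close>

definition half_space :: "((real ^ 'n::finite) \<times> real) set" where
  "half_space = {z. snd z > 0}"

definition hyperbolic_metric :: "((real ^ 'n::finite) \<times> real) metric" where
  "hyperbolic_metric z p q = (p \<bullet> q) / (snd z)\<^sup>2"

definition half_ball :: "real \<Rightarrow> ((real ^ 'n::finite) \<times> real) set" where
  "half_ball r = {z\<in>half_space. norm z < r}"


section \<open>Weighted Sobolev spaces\<close>

text \<open>Weak first derivatives are tested against \<open>C\<^sup>1\<close> functions of compact support, as in
  Gilbarg and Trudinger; \<open>W\<^sup>1\<^sup>,\<^sup>1\<close> locally on \<open>\<Omega>\<close> means that such a locally integrable gradient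
  exists.\<close>

definition has_weak_gradient ::
    "'a::euclidean_space set \<Rightarrow> ('a \<Rightarrow> real) \<Rightarrow> ('a \<Rightarrow> 'a) \<Rightarrow> bool" where
  "has_weak_gradient \<Omega> u G \<longleftrightarrow>
     (\<forall>K. compact K \<and> K \<subseteq> \<Omega> \<longrightarrow> u absolutely_integrable_on K \<and> G absolutely_integrable_on K) \<and>
     (\<forall>\<phi>\<in>C1c \<Omega>. \<forall>b\<in>Basis.
        (LINT z:\<Omega>|lebesgue. u z * partial_deriv b \<phi> z) = - (LINT z:\<Omega>|lebesgue. (G z \<bullet> b) * \<phi> z))"

text \<open>The integral of \<open>(|G|\<^sup>2 + u\<^sup>2) y\<^sup>a\<close> over the half-ball of radius \<open>r\<close>, where \<open>G\<close> is the weak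
  gradient of \<open>u\<close>.\<close>

definition energy ::
    "real \<Rightarrow> real \<Rightarrow> ((real ^ 'n::finite) \<times> real \<Rightarrow> real) \<Rightarrow>
     ((real ^ 'n) \<times> real \<Rightarrow> (real ^ 'n) \<times> real) \<Rightarrow> ennreal" where
  "energy a r u G =
     (\<integral>\<^sup>+z\<in>half_ball r. ennreal (((norm (G z))\<^sup>2 + (u z)\<^sup>2) * snd z powr a) \<partial>lebesgue)"

definition H1 :: "real \<Rightarrow> ((real ^ 'n::finite) \<times> real \<Rightarrow> real) set" where
  "H1 a = {u. \<exists>G. has_weak_gradient half_space u G \<and> (\<forall>r>0. energy a r u G < \<infinity>)}"

definition H1_tilde :: "real \<Rightarrow> ((real ^ 'n::finite) \<times> real \<Rightarrow> real) set" where
  "H1_tilde a = {u\<in>H1 a. \<forall>r>0. \<exists>\<phi> D.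
     (\<forall>k. \<phi> k \<in> C1c (closure (half_ball r) - {z. snd z = 0}) \<and>
          has_weak_gradient (half_ball r) (\<lambda>z. u z - \<phi> k z) (D k)) \<and>
     (\<lambda>k::nat. energy a r (\<lambda>z. u z - \<phi> k z) (D k)) \<longlonglongrightarrow> 0}"

end

theory Submission
  imports Defs
begin

text \<open>
  Put \<open>m = n - s\<close>. The equation for \<open>v\<close> says that \<open>w = 1 - v / y\<^sup>m\<close> satisfies
  \<open>div (y\<^sup>a \<nabla>w) = 0\<close>. The bound \<open>|\<nabla>\<rho>| \<le> 1\<close>, read vertically, says that \<open>\<rho> / y\<close> decreases in \<open>y\<close>, so \<open>w\<close>
  increases in \<open>y\<close>; since \<open>w\<close> has trace zero, \<open>0 \<le> w < 1\<close>. Testing the equation against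
  \<open>y\<^sup>2\<^sup>\<gamma> \<eta>(|z|)\<close>, which also vanishes at \<open>y = 0\<close>, shows that the measure \<open>w y dz\<close> annihilates the radial
  Laplacians of \<open>\<eta>\<close> in dimension \<open>n + 2 + 2\<gamma>\<close>. Hence the mass of a half-ball of radius \<open>R\<close> scales
  like \<open>R\<close> to the power \<open>n + 2 + 2\<gamma>\<close>, whereas \<open>w < 1\<close> only allows growth of order \<open>n + 2\<close>; so \<open>w = 0\<close>.
  No boundary regularity is needed: the trace condition enters only through the fact that the
  integrals of \<open>w\<close> over the layers \<open>\<epsilon> < y < 4\<epsilon>\<close>, weighted by \<open>1/\<epsilon>\<close>, tend to zero.
\<close>


text \<open>The factor y^(2\<gamma>) solves (y^a \<kappa>')' = 0 and vanishes at y = 0. The weighted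
  normal derivative of w at the boundary is not controlled, and a test function that vanishes there
  removes it. Truncating the factor at height \<epsilon> leaves one layer integral to estimate. What
  remains pairs w with y \<Delta>\<eta> + (1 + 2\<gamma>) \<partial>_y \<eta>, where y^(1+2\<gamma>)
  acts as the volume density of a radius in 2 + 2\<gamma> dimensions. The scaling of the mass is
  extracted without differentiating in the radius. Testing with powers of (r^2 - |z|^2)_+ at one
  fixed r gives a recursion in the power k. For r^2 = k the weight (1 - |z|^2/k)^k tends to a
  Gaussian, so the k-th moment controls the mass of every fixed ball. The recursion is solved by
  quotients of Gamma functions that decay like k^(-\<alpha>), \<alpha> = (n + 2 + 2\<gamma>)/2,
  while the bound on w contributes only k^((n+2)/2). The surplus k^(-\<gamma>) forces the mass to
  vanish.\<close>

section \<open>Integrals of directional derivatives\<close>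

lemma DERIV_eventually_zero:
  fixes f :: "real \<Rightarrow> real"
  assumes "\<forall>\<^sub>F t in nhds x. f t = 0"
  shows "(f has_real_derivative 0) (at x)"
  by (subst DERIV_cong_ev[OF refl assms refl]) simp

text \<open>Difference quotients of \<open>f\<close> along \<open>b\<close> have integral zero by
  translation invariance, and dominated convergence passes this on to \<open>g\<close>. Only the
  derivative in one direction has to be continuous, which suits fluxes that are integrated component
  by component.\<close>

lemma integral_directional_derivative_zero:
  fixes f g :: "'a::euclidean_space \<Rightarrow> real"
  assumes K: "compact K" "\<And>z. z \<notin> K \<Longrightarrow> f z = 0"
    and contf: "continuous_on UNIV f" and contg: "continuous_on UNIV g"
    and der: "\<And>z. ((\<lambda>t. f (z + t *\<^sub>R b)) has_real_derivative g z) (at 0)"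
  shows "integral\<^sup>L lborel g = 0"
proof -
  have der': "((\<lambda>s. f (z + s *\<^sub>R b)) has_real_derivative g (z + t *\<^sub>R b)) (at t)" for z t
  proof -
    have "((\<lambda>x. f (z + (x + t) *\<^sub>R b)) has_real_derivative g (z + t *\<^sub>R b)) (at 0)"
      using der[of "z + t *\<^sub>R b"] by (simp add: algebra_simps)
    then show ?thesis
      using DERIV_shift[of "\<lambda>s. f (z + s *\<^sub>R b)" "g (z + t *\<^sub>R b)" 0 t] by simp
  qed
  \<comment> \<open>\<open>K'\<close> contains the supports of all difference quotients of step at
    most 1; with the mean value theorem this gives the dominating function
    \<open>M * indicator K'\<close>.\<close>
  define K' where "K' = (\<lambda>(x, t). x - t *\<^sub>R b) ` (K \<times> {0..1::real})"
  have cK': "compact K'"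
    unfolding K'_def
    by (intro compact_continuous_image compact_Times K)
       (auto intro!: continuous_intros simp: case_prod_unfold)
  have K'I: "z \<in> K'" if "z + t *\<^sub>R b \<in> K" "0 \<le> t" "t \<le> 1" for z t
    unfolding K'_def using that by (intro image_eqI[of _ _ "(z + t *\<^sub>R b, t)"]) auto
  have g0: "g z = 0" if "z \<notin> K" for z
  proof -
    have "open (- K)" using K(1) by (simp add: compact_imp_closed open_Compl)
    then have "\<forall>\<^sub>F x in nhds z. x \<in> - K"
      using that by (intro eventually_nhds_in_open) auto
    moreover have "((\<lambda>t. z + t *\<^sub>R b) \<longlongrightarrow> z) (nhds 0)"
      using isCont_def by (auto intro!: tendsto_eq_intros filterlim_ident)
    ultimately have "\<forall>\<^sub>F t in nhds (0::real). z + t *\<^sub>R b \<in> - K"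
      by (rule eventually_compose_filterlim)
    then have "\<forall>\<^sub>F t in nhds (0::real). f (z + t *\<^sub>R b) = 0"
      by eventually_elim (use K(2) in auto)
    then have "((\<lambda>t. f (z + t *\<^sub>R b)) has_real_derivative 0) (at 0)"
      by (rule DERIV_eventually_zero)
    then show ?thesis using der DERIV_unique by blast
  qed
  obtain M where M: "\<And>z. z \<in> K \<Longrightarrow> \<bar>g z\<bar> \<le> M" and M0: "0 \<le> M"
  proof -
    have "bounded (g ` K)"
      by (intro compact_imp_bounded compact_continuous_image K continuous_on_subset[OF contg]) auto
    then obtain M where "\<forall>x\<in>g ` K. norm x \<le> M" unfolding bounded_iff by auto
    then show ?thesis using that[of "max M 0"] by force
  qed
  have gM: "\<bar>g z\<bar> \<le> M" for z using M g0 M0 by (cases "z \<in> K") auto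
  define T where "T = (\<lambda>i::nat. inverse (real (Suc i)))"
  have T: "0 < T i" "T i \<le> 1" for i unfolding T_def by (auto simp: field_simps)
  have Tn0: "T i \<noteq> 0" for i using T(1)[of i] by simp
  have Tlim: "T \<longlonglongrightarrow> 0" unfolding T_def by (rule LIMSEQ_inverse_real_of_nat)
  define q where "q = (\<lambda>i z. (f (z + T i *\<^sub>R b) - f z) / T i)"
  have fint: "integrable lborel f"
  proof -
    have "integrable lborel (\<lambda>x. indicator K x *\<^sub>R f x)"
      by (intro borel_integrable_compact K continuous_on_subset[OF contf]) auto
    moreover have "(\<lambda>x. indicator K x *\<^sub>R f x) = f"
      by (rule ext, case_tac "x \<in> K") (simp_all add: K(2))
    ultimately show ?thesis by simp
  qed
  have fmeas: "f \<in> borel_measurable borel" 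
    using contf by (rule borel_measurable_continuous_onI)
  have tr: "integrable lborel (\<lambda>z. f (z + c))" "(LINT z|lborel. f (z + c)) = integral\<^sup>L lborel f" for c
  proof -
    have eq: "distr lborel borel ((+) c) = (lborel :: 'a measure)" by (rule lborel_distr_plus)
    have "integrable (distr lborel borel ((+) c)) f" unfolding eq by (rule fint)
    then show "integrable lborel (\<lambda>z. f (z + c))"
      by (subst (asm) integrable_distr_eq) (auto simp: fmeas add.commute)
    have "integral\<^sup>L (distr lborel borel ((+) c)) f = (LINT z|lborel. f (c + z))"
      by (rule integral_distr) (auto simp: fmeas)
    then show "(LINT z|lborel. f (z + c)) = integral\<^sup>L lborel f" 
      unfolding eq by (simp add: add.commute)
  qed
  have qint: "integral\<^sup>L lborel (q i) = 0" for i
    unfolding q_def using tr fint by simp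
  have lim: "(\<lambda>i. integral\<^sup>L lborel (q i)) \<longlonglongrightarrow> integral\<^sup>L lborel g"
  proof (rule integral_dominated_convergence[where w = "\<lambda>z. M * indicator K' z"])
    show "g \<in> borel_measurable lborel" using borel_measurable_continuous_onI[OF contg] by simp
    show "q i \<in> borel_measurable lborel" for i
      unfolding q_def using tr(1) fint by (auto intro!: borel_measurable_divide borel_measurable_diff)
    show "integrable lborel (\<lambda>z. M * indicator K' z)"
      using cK' emeasure_compact_finite[OF cK']
      by (intro integrable_mult_right integrable_real_indicator) (auto simp: borel_compact)
    show "AE x in lborel. (\<lambda>i. q i x) \<longlonglongrightarrow> g x"
    proof (rule AE_I2)
      fix x :: 'a
      have "((\<lambda>h. (f (x + h *\<^sub>R b) - f x) / h) \<longlongrightarrow> g x) (at 0)"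
        using der[of x] unfolding has_field_derivative_iff by simp
      moreover have "filterlim T (at 0) sequentially"
        using Tlim Tn0 by (simp add: filterlim_at)
      ultimately show "(\<lambda>i. q i x) \<longlonglongrightarrow> g x"
        unfolding q_def by (rule filterlim_compose)
    qed
    show "AE x in lborel. norm (q i x) \<le> M * indicator K' x" for i
    proof (rule AE_I2)
      fix x :: 'a
      show "norm (q i x) \<le> M * indicator K' x"
      proof (cases "x \<in> K'")
        case True
        obtain s where s: "f (x + T i *\<^sub>R b) - f (x + 0 *\<^sub>R b) = (T i - 0) * g (x + s *\<^sub>R b)"
          using MVT2[of 0 "T i" "\<lambda>t. f (x + t *\<^sub>R b)" "\<lambda>t. g (x + t *\<^sub>R b)"] T[of i] der' by blast
        have "q i x = g (x + s *\<^sub>R b)" unfolding q_def using s T[of i] by (simp add: field_simps)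
        then show ?thesis using gM True by simp
      next
        case False
        have "x \<notin> K" using K'I[of x 0] False by auto
        moreover have "x + T i *\<^sub>R b \<notin> K" using K'I[of x "T i"] False T[of i] by auto
        ultimately show ?thesis using False by (simp add: q_def K(2))
      qed
    qed
  qed
  then show ?thesis by (simp add: qint LIMSEQ_const_iff)
qed

text \<open>Extension by zero reduces this to the whole space: \<open>K\<close> is compact inside
  \<open>S\<close>, so the open sets \<open>S\<close> and \<open>- K\<close> cover everything, and
  on each of them the extension is continuous.\<close>

lemma set_integral_directional_derivative_zero:
  fixes f g :: "'a::euclidean_space \<Rightarrow> real"
  assumes S: "open S" and K: "compact K" "K \<subseteq> S" "\<And>z. z \<in> S - K \<Longrightarrow> f z = 0"
    and contf: "continuous_on S f" and contg: "continuous_on S g"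
    and der: "\<And>z. z \<in> S \<Longrightarrow> ((\<lambda>t. f (z + t *\<^sub>R b)) has_real_derivative g z) (at 0)"
  shows "(LINT z:S|lborel. g z) = 0"
proof -
  define F where "F = (\<lambda>z. indicator S z * f z)"
  define G where "G = (\<lambda>z. indicator S z * g z)"
  have line: "((\<lambda>t. z + t *\<^sub>R b) \<longlongrightarrow> z) (nhds 0)" for z
    by (auto intro!: tendsto_eq_intros filterlim_ident)
  have ev: "\<forall>\<^sub>F t in nhds (0::real). z + t *\<^sub>R b \<in> U" if "open U" "z \<in> U" for z U
    using eventually_compose_filterlim[OF eventually_nhds_in_open[OF that] line] .
  have oK: "open (- K)" using K(1) by (simp add: compact_imp_closed open_Compl)
  have F0: "F z = 0" if "z \<notin> K" for z using K(3) that by (auto simp: F_def indicator_def)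
  have g0: "g z = 0" if "z \<in> S - K" for z
  proof -
    have "\<forall>\<^sub>F t in nhds (0::real). z + t *\<^sub>R b \<in> S \<inter> - K"
      using that S oK by (intro ev) auto
    then have "\<forall>\<^sub>F t in nhds (0::real). f (z + t *\<^sub>R b) = 0"
      by eventually_elim (use K(3) in auto)
    then have "((\<lambda>t. f (z + t *\<^sub>R b)) has_real_derivative 0) (at 0)"
      by (rule DERIV_eventually_zero)
    then show ?thesis using der[of z] that DERIV_unique by blast
  qed
  have G0: "G z = 0" if "z \<notin> K" for z using g0 that by (auto simp: G_def indicator_def)
  have ext: "continuous_on UNIV h" if h: "\<And>z. z \<notin> K \<Longrightarrow> h z = 0" "continuous_on S h" for h :: "'a \<Rightarrow> real"
  proof -
    have "continuous_on (- K) h"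
      by (rule continuous_on_eq[of _ "\<lambda>_. 0"]) (simp_all add: h(1))
    then have "continuous_on (S \<union> - K) h"
      by (intro continuous_on_open_Un S oK h(2))
    moreover have "S \<union> - K = UNIV" using K(2) by auto
    ultimately show ?thesis by simp
  qed
  have "integral\<^sup>L lborel G = 0"
  proof (rule integral_directional_derivative_zero[of K F G b])
    show "continuous_on UNIV F"
      by (rule ext, erule F0, rule continuous_on_eq[OF contf], simp add: F_def)
    show "continuous_on UNIV G"
      by (rule ext, erule G0, rule continuous_on_eq[OF contg], simp add: G_def)
    fix z
    show "((\<lambda>t. F (z + t *\<^sub>R b)) has_real_derivative G z) (at 0)"
    proof (cases "z \<in> S")
      case True
      have "\<forall>\<^sub>F t in nhds (0::real). F (z + t *\<^sub>R b) = f (z + t *\<^sub>R b)"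
        using ev[OF S True] by eventually_elim (simp add: F_def)
      then show ?thesis
        using der[OF True] True by (subst DERIV_cong_ev[OF refl _ refl]) (auto simp: G_def)
    next
      case False
      then have z: "z \<in> - K" using K by auto
      have "\<forall>\<^sub>F t in nhds (0::real). F (z + t *\<^sub>R b) = 0"
        using ev[OF oK z] by eventually_elim (simp add: F0)
      then have "((\<lambda>t. F (z + t *\<^sub>R b)) has_real_derivative 0) (at 0)"
        by (rule DERIV_eventually_zero)
      then show ?thesis using G0 z by simp
    qed
  qed (use F0 K in auto)
  then show ?thesis by (simp add: G_def set_lebesgue_integral_def)
qed

section \<open>Test functions against the weighted energy\<close>

lemma open_half_space: "open (half_space :: ((real ^ 'n::finite) \<times> real) set)"
  unfolding half_space_def by (intro open_Collect_less continuous_intros)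

lemma open_half_ball: "open (half_ball r :: ((real ^ 'n::finite) \<times> real) set)"
proof -
  have "half_ball r = half_space \<inter> {z :: (real ^ 'n) \<times> real. norm z < r}"
    by (auto simp: half_ball_def)
  then show ?thesis
    by (auto intro!: open_Int open_half_space open_Collect_less continuous_intros)
qed

text \<open>The half-ball lies in a ball of the horizontal space times an interval, and Tonelli
  leaves the integral of y^a from 0 on. It is applied to the dual weight y^(-a), which is where a <
  1 enters.\<close>

lemma nn_integral_powr_half_ball_finite:
  assumes "a > -1"
  shows "(\<integral>\<^sup>+z\<in>(half_ball r :: ((real ^ 'n::finite) \<times> real) set). ennreal (snd z powr a) \<partial>lebesgue) < \<infinity>"
proof -
  define g where "g = (\<lambda>y::real. ennreal (y powr a) * indicator {0..max r 0} y)"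
  define f where "f = (\<lambda>z::(real ^ 'n) \<times> real. indicator (cball 0 r) (fst z) * g (snd z))"
  have gm[measurable]: "g \<in> borel_measurable borel" unfolding g_def by measurable
  have "(\<integral>\<^sup>+z\<in>(half_ball r :: ((real ^ 'n::finite) \<times> real) set). ennreal (snd z powr a) \<partial>lebesgue)
      \<le> (\<integral>\<^sup>+z. f z \<partial>lebesgue)"
  proof (rule nn_integral_mono)
    fix z :: "(real ^ 'n) \<times> real"
    show "ennreal (snd z powr a) * indicator (half_ball r) z \<le> f z"
    proof (cases "z \<in> half_ball r")
      case True
      have "norm (fst z) \<le> norm z" "\<bar>snd z\<bar> \<le> norm z"
        using norm_fst_le[of "fst z" "snd z"] norm_snd_le[of "snd z" "fst z"] by simp_all
      then show ?thesis using True by (auto simp: f_def g_def half_ball_def half_space_def)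
    qed simp
  qed
  also have "(\<integral>\<^sup>+z. f z \<partial>lebesgue) = (\<integral>\<^sup>+z. f z \<partial>lborel)"
    by (rule nn_integral_completion)
  also have "\<dots> = (\<integral>\<^sup>+z. f z \<partial>(lborel \<Otimes>\<^sub>M lborel))"
    by (simp add: lborel_prod)
  also have "\<dots> = (\<integral>\<^sup>+x. \<integral>\<^sup>+y. f (x, y) \<partial>lborel \<partial>lborel)"
  proof (rule lborel.nn_integral_fst[symmetric])
    have "(\<lambda>z. indicator (cball 0 r) (fst z) :: ennreal) \<in> borel_measurable (lborel \<Otimes>\<^sub>M lborel :: ((real ^ 'n) \<times> real) measure)"
      by (rule measurable_compose[OF measurable_fst]) (auto intro!: borel_measurable_indicator)
    moreover have "(\<lambda>z. g (snd z)) \<in> borel_measurable (lborel \<Otimes>\<^sub>M lborel :: ((real ^ 'n) \<times> real) measure)"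
      by (rule measurable_compose[OF measurable_snd]) simp
    ultimately show "f \<in> borel_measurable (lborel \<Otimes>\<^sub>M lborel)"
      unfolding f_def by (rule borel_measurable_times_ennreal)
  qed
  also have "\<dots> = (\<integral>\<^sup>+x. indicator (cball 0 r) (x :: real ^ 'n) * (\<integral>\<^sup>+y. g y \<partial>lborel) \<partial>lborel)"
    by (simp add: f_def nn_integral_cmult)
  also have "\<dots> = emeasure lborel (cball (0 :: real ^ 'n) r) * (\<integral>\<^sup>+y. g y \<partial>lborel)"
    by (subst nn_integral_multc) (auto intro!: borel_measurable_indicator)
  also have "(\<integral>\<^sup>+y. g y \<partial>lborel) = ennreal (max r 0 powr (a + 1) / (a + 1))"
    unfolding g_def by (rule nn_integral_has_integral_lebesgue') (auto intro!: has_integral_powr_from_0 assms)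
  also have "emeasure lborel (cball (0 :: real ^ 'n) r) * \<dots> < \<infinity>"
    using emeasure_compact_finite[of "cball (0 :: real ^ 'n) r"] by (simp add: ennreal_mult_less_top)
  finally show ?thesis .
qed

lemma set_integrable_mult_compact_support:
  fixes f h :: "'a::euclidean_space \<Rightarrow> real"
  assumes K: "K \<subseteq> S" and f: "f absolutely_integrable_on K"
    and h: "h \<in> borel_measurable borel" "\<And>z. \<bar>h z\<bar> \<le> M" "\<And>z. z \<in> S - K \<Longrightarrow> h z = 0"
  shows "set_integrable lebesgue S (\<lambda>z. f z * h z)"
proof -
  have f': "integrable lebesgue (\<lambda>z. indicator K z *\<^sub>R f z)" 
    using f unfolding set_integrable_def .
  have "h \<in> borel_measurable lebesgue" using h(1) by (simp add: measurable_completion)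
  then have "integrable lebesgue (\<lambda>z. (indicator K z *\<^sub>R f z) * h z)"
    using borel_measurable_integrable[OF f']
    by (intro Bochner_Integration.integrable_bound[OF integrable_mult_right[OF f', of M]])
      (auto intro!: AE_I2 mult_right_mono borel_measurable_times simp: abs_mult mult.commute h(2)
        order_trans[OF h(2) abs_ge_self])
  moreover have "(\<lambda>z. (indicator K z *\<^sub>R f z) * h z) = (\<lambda>z. indicator S z *\<^sub>R (f z * h z))"
    using K h(3) by (auto simp: indicator_def fun_eq_iff)
  ultimately show ?thesis unfolding set_integrable_def by simp
qed

text \<open>A Cauchy-Schwarz inequality in additive form: the weight y^a goes to \<open>f\<close>,
  its reciprocal to \<open>h\<close>, and \<open>l\<close> balances the two. The hypothesis
  \<open>fb\<close> allows \<open>f\<close> to be \<open>u\<close> itself or a component of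
  \<open>G\<close>.\<close>

lemma energy_pairing_bound:
  fixes f u h :: "(real ^ 'n::finite) \<times> real \<Rightarrow> real"
  assumes K: "compact K" "K \<subseteq> half_ball r" and f: "f absolutely_integrable_on K"
    and h: "\<And>z. \<bar>h z\<bar> \<le> M" "\<And>z. z \<in> half_ball r - K \<Longrightarrow> h z = 0"
    and fb: "\<And>z. (f z)\<^sup>2 \<le> (norm (G z))\<^sup>2 + (u z)\<^sup>2"
    and en: "energy a r u G \<le> ennreal E"
    and C: "(\<integral>\<^sup>+z\<in>(half_ball r :: ((real ^ 'n) \<times> real) set). ennreal (snd z powr (-a)) \<partial>lebesgue) \<le> ennreal C"
    and pos: "0 < l" "0 \<le> E" "0 \<le> C"
  shows "\<bar>LINT z:half_ball r|lebesgue. f z * h z\<bar> \<le> l * E + M\<^sup>2 / l * C"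
proof -
  define F where "F = (\<lambda>z. indicator (half_ball r) z *\<^sub>R (f z * h z))"
  define A where "A = (\<lambda>z. ennreal (l * (indicator K z *\<^sub>R f z)\<^sup>2 * snd z powr a))"
  define B where "B = (\<lambda>z::(real ^ 'n) \<times> real. ennreal (M\<^sup>2 / l) * (ennreal (snd z powr (-a)) * indicator (half_ball r) z))"
  have f': "(\<lambda>z. indicator K z *\<^sub>R f z) \<in> borel_measurable lebesgue" 
    using f unfolding set_integrable_def by (rule borel_measurable_integrable)
  have HB: "half_ball r \<in> sets (lebesgue :: ((real ^ 'n) \<times> real) measure)"
    by (rule sets_completionI_sets) (simp add: borel_open open_half_ball)
  have pm: "(\<lambda>z::(real ^ 'n) \<times> real. snd z powr c) \<in> borel_measurable lebesgue" for c
  proof (intro measurable_completion)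
    have "snd \<in> borel_measurable (borel :: ((real ^ 'n) \<times> real) measure)"
      by (intro borel_measurable_continuous_onI continuous_intros)
    then show "(\<lambda>z::(real ^ 'n) \<times> real. snd z powr c) \<in> borel_measurable lborel"
      by measurable
  qed
  have Am: "A \<in> borel_measurable lebesgue"
    unfolding A_def using f' pm by measurable
  have Bm: "B \<in> borel_measurable lebesgue"
    unfolding B_def using pm[of "-a"] HB
    by (intro borel_measurable_times_ennreal borel_measurable_const borel_measurable_indicator) auto
  have pw: "ennreal (norm (F z)) \<le> A z + B z" for z
  proof (cases "z \<in> K")
    case True
    then have z: "z \<in> half_ball r" and y: "snd z > 0" using K by (auto simp: half_ball_def half_space_def)
    define p where "p = snd z powr a"
    have p: "p > 0" "snd z powr (-a) = 1 / p" using y by (auto simp: p_def powr_minus_divide)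
    have amgm: "\<bar>x * c\<bar> \<le> l * x\<^sup>2 * p + c\<^sup>2 / l * (1 / p)" for x c :: real
    proof -
      have "0 \<le> (l * p * \<bar>x\<bar> - \<bar>c\<bar>)\<^sup>2" by simp
      then have "2 * (l * p * \<bar>x * c\<bar>) \<le> (l * p)\<^sup>2 * x\<^sup>2 + c\<^sup>2"
        by (simp add: power2_diff power_mult_distrib abs_mult algebra_simps)
      moreover have "0 \<le> l * p * \<bar>x * c\<bar>" using pos p by simp
      ultimately have "l * p * \<bar>x * c\<bar> \<le> (l * p)\<^sup>2 * x\<^sup>2 + c\<^sup>2" by linarith
      then show ?thesis using pos p by (simp add: field_simps power2_eq_square)
    qed
    have "h z ^ 2 \<le> M\<^sup>2" using h(1)[of z] by (metis abs_le_square_iff abs_of_nonneg abs_ge_zero order_trans)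
    then have "(h z)\<^sup>2 / l * (1 / p) \<le> M\<^sup>2 / l * (1 / p)" using pos p by (intro mult_right_mono divide_right_mono) auto
    then have "norm (F z) \<le> l * (f z)\<^sup>2 * p + M\<^sup>2 / l * (1 / p)"
      using amgm[of "f z" "h z"] z by (simp add: F_def)
    then have "ennreal (norm (F z)) \<le> ennreal (l * (f z)\<^sup>2 * p + M\<^sup>2 / l * (1 / p))" by (rule ennreal_leI)
    also have "\<dots> = ennreal (l * (f z)\<^sup>2 * p) + ennreal (M\<^sup>2 / l * (1 / p))"
      using pos p by (intro ennreal_plus) auto
    also have "ennreal (M\<^sup>2 / l * (1 / p)) = B z"
      unfolding B_def p(2) using z pos p(1) by (subst ennreal_mult) auto
    also have "ennreal (l * (f z)\<^sup>2 * p) = A z" 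
      using True by (simp add: A_def p_def)
    finally show ?thesis .
  next
    case False
    then have "F z = 0" using h(2) by (auto simp: F_def indicator_def)
    then show ?thesis by simp
  qed
  \<comment> \<open>If \<open>F\<close> is not integrable, its Bochner integral is 0 by convention
    and the bound is trivial.\<close>
  have "ennreal \<bar>integral\<^sup>L lebesgue F\<bar> \<le> (\<integral>\<^sup>+z. ennreal (norm (F z)) \<partial>lebesgue)"
    using integral_norm_bound_ennreal[of lebesgue F] by (cases "integrable lebesgue F") (auto simp: not_integrable_integral_eq)
  also have "\<dots> \<le> (\<integral>\<^sup>+z. A z + B z \<partial>lebesgue)" by (intro nn_integral_mono pw)
  also have "\<dots> = (\<integral>\<^sup>+z. A z \<partial>lebesgue) + (\<integral>\<^sup>+z. B z \<partial>lebesgue)"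
    by (rule nn_integral_add[OF Am Bm])
  finally have tot: "ennreal \<bar>integral\<^sup>L lebesgue F\<bar> \<le> (\<integral>\<^sup>+z. A z \<partial>lebesgue) + (\<integral>\<^sup>+z. B z \<partial>lebesgue)" .
  have Ble: "(\<integral>\<^sup>+z. B z \<partial>lebesgue) \<le> ennreal (M\<^sup>2 / l) * ennreal C"
    unfolding B_def using pm[of "-a"] HB C
    by (subst nn_integral_cmult)
      (auto intro!: borel_measurable_times_ennreal borel_measurable_indicator mult_left_mono)
  have Ale: "(\<integral>\<^sup>+z. A z \<partial>lebesgue) \<le> ennreal l * energy a r u G"
  proof -
    have "A z = ennreal l * ennreal ((indicator K z *\<^sub>R f z)\<^sup>2 * snd z powr a)" for z
      unfolding A_def using pos by (simp add: ennreal_mult[symmetric] mult.assoc)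
    then have "(\<integral>\<^sup>+z. A z \<partial>lebesgue) = ennreal l * (\<integral>\<^sup>+z. ennreal ((indicator K z *\<^sub>R f z)\<^sup>2 * snd z powr a) \<partial>lebesgue)"
      using f' pm by (simp add: nn_integral_cmult)
    also have "\<dots> \<le> ennreal l * energy a r u G"
      unfolding energy_def
    proof (intro mult_left_mono nn_integral_mono)
      fix z
      show "ennreal ((indicator K z *\<^sub>R f z)\<^sup>2 * snd z powr a)
        \<le> ennreal (((norm (G z))\<^sup>2 + (u z)\<^sup>2) * snd z powr a) * indicator (half_ball r) z"
        using subsetD[OF K(2), of z] fb[of z]
        by (cases "z \<in> K") (auto intro!: ennreal_leI mult_right_mono)
    qed simp
    finally show ?thesis .
  qed
  have Ele: "ennreal l * energy a r u G \<le> ennreal l * ennreal E" by (intro mult_left_mono en) simp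
  have "ennreal \<bar>integral\<^sup>L lebesgue F\<bar> \<le> ennreal l * ennreal E + ennreal (M\<^sup>2 / l) * ennreal C"
    using tot add_mono[OF order_trans[OF Ale Ele] Ble] by (rule order_trans)
  also have "\<dots> = ennreal (l * E + M\<^sup>2 / l * C)"
    using pos by (simp add: ennreal_mult[symmetric] ennreal_plus[symmetric] del: ennreal_plus)
  finally show ?thesis
    using pos unfolding F_def set_lebesgue_integral_def by (subst (asm) ennreal_le_iff) auto
qed

lemma has_derivative_inner_imp_C1:
  fixes f :: "'a::euclidean_space \<Rightarrow> real"
  assumes der: "\<And>z. (f has_derivative (\<lambda>h. G z \<bullet> h)) (at z)" and G: "continuous_on UNIV G"
  shows "Ck_on 1 f UNIV" and "partial_deriv b f z = G z \<bullet> b"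
proof -
  have pd: "partial_deriv b f = (\<lambda>z. G z \<bullet> b)" for b
  proof
    fix z
    show "partial_deriv b f z = G z \<bullet> b"
      unfolding partial_deriv_def using frechet_derivative_at[OF der[of z], symmetric] by simp
  qed
  show "Ck_on 1 f UNIV"
    using der G by (auto simp: pd differentiable_def intro!: continuous_intros)
  show "partial_deriv b f z = G z \<bullet> b" by (simp add: pd)
qed

lemma compact_support_bounded:
  fixes f :: "'a::euclidean_space \<Rightarrow> 'b::real_normed_vector"
  assumes "continuous_on UNIV f" "\<And>z. norm z \<ge> R \<Longrightarrow> f z = 0"
  obtains M where "\<And>z. norm (f z) \<le> M" "M \<ge> 0"
proof -
  have "bounded (f ` cball 0 R)"
    by (intro compact_imp_bounded compact_continuous_image continuous_on_subset[OF assms(1)]) auto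
  then obtain M where M: "\<And>x. x \<in> f ` cball 0 R \<Longrightarrow> norm x \<le> M" unfolding bounded_iff by auto
  have "norm (f z) \<le> max M 0" for z
    using M[of "f z"] assms(2)[of z] by (cases "norm z \<le> R") (auto simp: le_max_iff_disj)
  then show ?thesis using that[of "max M 0"] by auto
qed

text \<open>Below the support of an approximant \<phi> the function \<open>w\<close> coincides with
  the error u = w - \<phi>, so a thin layer sees only u. Integration by parts in y trades the
  singular factor 1/\<epsilon> for bounded test functions paired with u and its weak gradient, and
  the energy of u bounds these pairings uniformly in \<epsilon>. The lemma is used with
  \<open>step\<close> and with \<open>cutoff \<gamma>\<close> as \<open>m\<close>.\<close>

lemma zero_trace_layer_integral:
  fixes w \<eta> :: "(real ^ 'n::finite) \<times> real \<Rightarrow> real" and m m' :: "real \<Rightarrow> real"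
  assumes a: "a < 1" and wH: "w \<in> H1_tilde a" and wc: "continuous_on half_space w"
    and \<eta>: "\<And>z. (\<eta> has_derivative (\<lambda>h. P z \<bullet> h)) (at z)" "continuous_on UNIV P"
      "\<And>z. norm z \<ge> R \<Longrightarrow> \<eta> z = 0" "\<And>z. norm z \<ge> R \<Longrightarrow> P z = 0"
    and m: "\<And>t. (m has_real_derivative m' t) (at t)" "continuous_on UNIV m'"
      "\<And>t. t \<le> 1 \<Longrightarrow> m t = 0" "\<And>t. t \<le> 1 \<Longrightarrow> m' t = 0" "\<And>t. t \<ge> 4 \<Longrightarrow> m' t = 0"
      "\<And>t. \<bar>m t\<bar> \<le> B"
    and \<delta>: "\<delta> > 0" and R: "R > 0"
  obtains \<epsilon>0 where "\<epsilon>0 > 0"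
    "\<And>\<epsilon>. 0 < \<epsilon> \<Longrightarrow> \<epsilon> < \<epsilon>0 \<Longrightarrow>
      \<bar>LINT z:half_space|lborel. w z * \<eta> z * (m' (snd z / \<epsilon>) / \<epsilon>)\<bar> \<le> \<delta>"
proof -
  define e :: "(real ^ 'n) \<times> real" where "e = (0, 1)"
  have e: "e \<in> Basis" "norm e = 1" by (auto simp: e_def Basis_prod_def norm_Pair)
  have sndz: "snd z = e \<bullet> z" for z :: "(real ^ 'n) \<times> real" by (simp add: e_def inner_prod_def)
  \<comment> \<open>The larger radius puts the support of \<open>\<eta>\<close> inside the open
    half-ball on which the approximation takes place.\<close>
  define r where "r = R + 1"
  define HB where "HB = (half_ball r :: ((real ^ 'n) \<times> real) set)"
  have \<eta>c: "continuous_on UNIV \<eta>"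
    using \<eta>(1) by (meson continuous_at_imp_continuous_on has_derivative_continuous)
  obtain M1 where M1: "\<And>z. \<bar>\<eta> z\<bar> \<le> M1" "M1 \<ge> 0"
    using compact_support_bounded[OF \<eta>c \<eta>(3)] by (metis real_norm_def)
  obtain M2 where M2: "\<And>z. norm (P z) \<le> M2" "M2 \<ge> 0"
    using compact_support_bounded[OF \<eta>(2,4)] by metis
  define M where "M = (M1 + M2) * B"
  have B0: "B \<ge> 0" using m(6)[of 0] by linarith
  have M0: "M \<ge> 0" unfolding M_def using B0 M1 M2 by auto
  define C0 where "C0 = (\<integral>\<^sup>+z\<in>HB. ennreal (snd z powr (-a)) \<partial>lebesgue)"
  have "C0 < \<infinity>" unfolding C0_def HB_def using a by (intro nn_integral_powr_half_ball_finite) auto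
  then obtain C where C: "C0 = ennreal C" "C \<ge> 0" by (cases C0) auto
  \<comment> \<open>First \<open>l\<close> makes the contribution of the dual weight at most
    \<delta>/4, then \<open>E\<close> makes that of the energy \<delta>/4. Two pairings are
    estimated in this way, so the total is \<delta>.\<close>
  define l where "l = 4 * M\<^sup>2 * C / \<delta> + 1"
  have l: "l > 0" unfolding l_def using C \<delta> by (intro add_nonneg_pos) auto
  have lC: "M\<^sup>2 / l * C \<le> \<delta> / 4"
    using l C \<delta> by (simp add: l_def field_simps)
  define E where "E = \<delta> / (4 * l)"
  have E: "E > 0" "l * E = \<delta> / 4" using l \<delta> by (auto simp: E_def)
  obtain \<phi> D where \<phi>: "\<And>k. \<phi> k \<in> C1c (closure HB - {z. snd z = 0})"
    and D: "\<And>k. has_weak_gradient HB (\<lambda>z. w z - \<phi> k z) (D k)"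
    and lim: "(\<lambda>k::nat. energy a r (\<lambda>z. w z - \<phi> k z) (D k)) \<longlonglongrightarrow> 0"
    using wH R unfolding H1_tilde_def HB_def r_def by (auto dest!: spec[of _ "R + 1"])
  have "\<forall>\<^sub>F k in sequentially. energy a r (\<lambda>z. w z - \<phi> k z) (D k) < ennreal E"
    using lim E by (intro order_tendstoD) auto
  \<comment> \<open>A single approximant, fixed before \<epsilon>, serves all small
    \<epsilon>.\<close>
  then obtain k where k: "energy a r (\<lambda>z. w z - \<phi> k z) (D k) < ennreal E"
    unfolding eventually_sequentially by auto
  define u where "u = (\<lambda>z. w z - \<phi> k z)"
  define G where "G = D k"
  have wg: "has_weak_gradient HB u G" unfolding u_def G_def by (rule D)
  have en: "energy a r u G \<le> ennreal E" using k by (simp add: u_def G_def)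
  obtain Kk where Kk: "compact Kk" "Kk \<subseteq> closure HB - {z. snd z = 0}"
     "\<And>z. z \<in> closure HB - {z. snd z = 0} - Kk \<Longrightarrow> \<phi> k z = 0"
    using \<phi>[of k] unfolding C1c_def by blast
  have cl: "snd z \<ge> 0" if "z \<in> closure HB" for z
  proof -
    have "closure HB \<subseteq> {z. snd z \<ge> 0}"
      by (intro closure_minimal closed_Collect_le continuous_intros)
        (auto simp: HB_def half_ball_def half_space_def)
    then show ?thesis using that by auto
  qed
  \<comment> \<open>A compact set in the closed half-ball that avoids y = 0 has positive distance
    from the boundary plane.\<close>
  obtain y0 where y0: "y0 > 0" "\<And>z. z \<in> Kk \<Longrightarrow> snd z \<ge> y0"
  proof (cases "Kk = {}")
    case True
    then show ?thesis using that[of 1] by auto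
  next
    case False
    have "continuous_on Kk snd" by (intro continuous_intros)
    then obtain z0 where z0: "z0 \<in> Kk" "\<And>z. z \<in> Kk \<Longrightarrow> snd z0 \<le> snd z"
      using continuous_attains_inf[OF Kk(1) False] by metis
    then have "snd z0 > 0" using cl[of z0] Kk(2) by force
    then show ?thesis using that z0 by blast
  qed
  show ?thesis
  \<comment> \<open>Since \<open>m'\<close> vanishes from 4 on, the layer of thickness \<epsilon> <
    y0/4 stays below the support of the approximant.\<close>
  proof (rule that[of "y0 / 4"])
    show "y0 / 4 > 0" using y0 by simp
    fix \<epsilon> :: real assume \<epsilon>: "0 < \<epsilon>" "\<epsilon> < y0 / 4"
    define T where "T = (\<lambda>z::(real ^ 'n) \<times> real. \<eta> z * m (snd z / \<epsilon>))"
    define Q where "Q = (\<lambda>z. m (snd z / \<epsilon>) *\<^sub>R P z + (\<eta> z * (m' (snd z / \<epsilon>) / \<epsilon>)) *\<^sub>R e)"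
    have mc: "continuous_on UNIV m" using m(1) by (meson DERIV_isCont continuous_at_imp_continuous_on)
    have mcs: "continuous_on UNIV (\<lambda>z::(real ^ 'n) \<times> real. m (snd z / \<epsilon>))"
      by (rule continuous_on_compose2[OF mc]) (use \<epsilon> in \<open>auto intro!: continuous_intros\<close>)
    have mcs': "continuous_on UNIV (\<lambda>z::(real ^ 'n) \<times> real. m' (snd z / \<epsilon>))"
      by (rule continuous_on_compose2[OF m(2)]) (use \<epsilon> in \<open>auto intro!: continuous_intros\<close>)
    have Tder: "(T has_derivative (\<lambda>h. Q z \<bullet> h)) (at z)" for z
    proof -
      have s: "((\<lambda>z::(real ^ 'n) \<times> real. snd z / \<epsilon>) has_derivative (\<lambda>h. snd h / \<epsilon>)) (at z)"
        using \<epsilon> by (auto intro!: derivative_eq_intros)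
      have "((\<lambda>z. m (snd z / \<epsilon>)) has_derivative (\<lambda>h. m' (snd z / \<epsilon>) * (snd h / \<epsilon>))) (at z)"
        using has_derivative_compose[OF s, of m "\<lambda>x. m' (snd z / \<epsilon>) * x"] m(1)[of "snd z / \<epsilon>"]
        by (simp add: has_field_derivative_def)
      from has_derivative_mult[OF \<eta>(1)[of z] this] show ?thesis
        unfolding T_def Q_def by (rule has_derivative_eq_rhs)
          (auto simp: fun_eq_iff inner_add_left sndz algebra_simps)
    qed
    have Qc: "continuous_on UNIV Q"
      unfolding Q_def using \<epsilon> by (intro continuous_intros mcs mcs' \<eta>c \<eta>(2)) auto
    note TC = has_derivative_inner_imp_C1[OF Tder Qc]
    define K where "K = cball 0 R \<inter> {z::(real ^ 'n) \<times> real. snd z \<ge> \<epsilon>}"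
    have Kc: "compact K" unfolding K_def
      by (intro compact_Int_closed closed_Collect_le continuous_intros) auto
    have KHB: "K \<subseteq> HB" using \<epsilon> by (auto simp: K_def HB_def half_ball_def half_space_def r_def)
    have notK: "\<eta> z = 0 \<and> P z = 0 \<or> m (snd z / \<epsilon>) = 0 \<and> m' (snd z / \<epsilon>) = 0" if "z \<notin> K" for z
      using that \<eta>(3,4)[of z] m(3,4)[of "snd z / \<epsilon>"] \<epsilon> by (auto simp: K_def)
    have "T \<in> C1c HB"
    proof -
      have "\<exists>U. open U \<and> HB \<subseteq> U \<and> Ck_on 1 T U" using TC(1) by (intro exI[of _ UNIV]) simp
      moreover have "\<exists>K. compact K \<and> K \<subseteq> HB \<and> (\<forall>z\<in>HB - K. T z = 0)"
        using Kc KHB notK by (intro exI[of _ K]) (auto simp: T_def)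
      ultimately show ?thesis by (simp add: C1c_def)
    qed
    then have "(LINT z:HB|lebesgue. u z * partial_deriv e T z) = - (LINT z:HB|lebesgue. (G z \<bullet> e) * T z)"
      using wg e unfolding has_weak_gradient_def by blast
    moreover have "partial_deriv e T z = m (snd z / \<epsilon>) * (P z \<bullet> e) + \<eta> z * (m' (snd z / \<epsilon>) / \<epsilon>)" for z
      using e by (simp add: TC(2) Q_def inner_add_left norm_eq_1)
    ultimately have ibp: "(LINT z:HB|lebesgue. u z * (m (snd z / \<epsilon>) * (P z \<bullet> e)) + u z * (\<eta> z * (m' (snd z / \<epsilon>) / \<epsilon>)))
        = - (LINT z:HB|lebesgue. (G z \<bullet> e) * T z)"
      by (simp add: algebra_simps)
    have uK: "u absolutely_integrable_on K" and GK: "G absolutely_integrable_on K"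
      using wg Kc KHB unfolding has_weak_gradient_def by auto
    have GeK: "(\<lambda>z. G z \<bullet> e) absolutely_integrable_on K"
      using absolutely_integrable_component[OF GK, of e] .
    define h1 where "h1 = (\<lambda>z. m (snd z / \<epsilon>) * (P z \<bullet> e))"
    define h2 where "h2 = (\<lambda>z. \<eta> z * (m' (snd z / \<epsilon>) / \<epsilon>))"
    have h1c: "continuous_on UNIV h1" unfolding h1_def by (intro continuous_intros mcs \<eta>(2))
    have h2c: "continuous_on UNIV h2" unfolding h2_def using \<epsilon> by (intro continuous_intros mcs' \<eta>c) auto
    have PM: "\<bar>P z \<bullet> e\<bar> \<le> M2" for z
      using Cauchy_Schwarz_ineq2[of "P z" e] M2(1)[of z] e by simp
    have h1M: "\<bar>h1 z\<bar> \<le> M" for z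
    proof -
      have "\<bar>h1 z\<bar> \<le> B * M2" unfolding h1_def abs_mult by (intro mult_mono m(6) PM B0) auto
      also have "\<dots> \<le> M" unfolding M_def using B0 M1 by (simp add: algebra_simps)
      finally show ?thesis .
    qed
    have TM: "\<bar>T z\<bar> \<le> M" for z
    proof -
      have "\<bar>T z\<bar> \<le> M1 * B" unfolding T_def abs_mult by (intro mult_mono m(6) M1) auto
      also have "\<dots> \<le> M" unfolding M_def using B0 M2 by (simp add: algebra_simps)
      finally show ?thesis .
    qed
    have h20: "h2 z = 0" if "norm z \<ge> R" for z using \<eta>(3)[OF that] by (simp add: h2_def)
    obtain M3 where M3: "\<And>z. \<bar>h2 z\<bar> \<le> M3"
      using compact_support_bounded[OF h2c h20] by (metis real_norm_def)
    have h0: "h1 z = 0" "h2 z = 0" "T z = 0" if "z \<notin> K" for z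
      using notK[OF that] by (auto simp: h1_def h2_def T_def)
    have i1: "set_integrable lebesgue HB (\<lambda>z. u z * h1 z)"
      by (rule set_integrable_mult_compact_support[OF KHB uK borel_measurable_continuous_onI[OF h1c] h1M])
        (simp add: h0)
    have i2: "set_integrable lebesgue HB (\<lambda>z. u z * h2 z)"
      by (rule set_integrable_mult_compact_support[OF KHB uK borel_measurable_continuous_onI[OF h2c] M3])
        (simp add: h0)
    have split: "(LINT z:HB|lebesgue. u z * h2 z)
        = - (LINT z:HB|lebesgue. (G z \<bullet> e) * T z) - (LINT z:HB|lebesgue. u z * h1 z)"
      using ibp set_integral_add(2)[OF i1 i2] unfolding h1_def[symmetric] h2_def[symmetric]
      by (simp add: h1_def h2_def)
    have b1: "\<bar>LINT z:HB|lebesgue. (G z \<bullet> e) * T z\<bar> \<le> l * E + M\<^sup>2 / l * C"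
      unfolding HB_def
    proof (rule energy_pairing_bound[OF Kc KHB[unfolded HB_def] GeK TM _ _ en])
      show "(G z \<bullet> e)\<^sup>2 \<le> (norm (G z))\<^sup>2 + (u z)\<^sup>2" for z
      proof -
        have "\<bar>G z \<bullet> e\<bar> \<le> \<bar>norm (G z)\<bar>" using Cauchy_Schwarz_ineq2[of "G z" e] e by simp
        then have "(G z \<bullet> e)\<^sup>2 \<le> (norm (G z))\<^sup>2" by (simp only: abs_le_square_iff)
        then show ?thesis by (simp add: add_increasing2)
      qed
    qed (use h0 C l E in \<open>auto simp: C0_def HB_def\<close>)
    have b2: "\<bar>LINT z:HB|lebesgue. u z * h1 z\<bar> \<le> l * E + M\<^sup>2 / l * C"
      unfolding HB_def
      by (rule energy_pairing_bound[OF Kc KHB[unfolded HB_def] uK h1M _ _ en])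
        (use h0 C l E in \<open>auto simp: u_def C0_def HB_def\<close>)
    have "\<bar>LINT z:HB|lebesgue. u z * h2 z\<bar> \<le> \<delta>"
      using split b1 b2 lC E by linarith
    also have "(LINT z:HB|lebesgue. u z * h2 z) = (LINT z:half_space|lebesgue. w z * h2 z)"
      unfolding set_lebesgue_integral_def
    proof (rule Bochner_Integration.integral_cong)
      fix z :: "(real ^ 'n) \<times> real"
      show "indicator HB z *\<^sub>R (u z * h2 z) = indicator half_space z *\<^sub>R (w z * h2 z)"
      proof (cases "z \<in> HB")
        case False
        then have "z \<notin> half_space \<or> norm z \<ge> R" by (auto simp: HB_def half_ball_def r_def)
        then show ?thesis using False h20[of z] by (cases "z \<in> half_space") auto
      next
        case True
        then have hs: "z \<in> half_space" "snd z > 0" by (auto simp: HB_def half_ball_def half_space_def)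
        have "\<phi> k z * h2 z = 0"
        proof (cases "z \<in> Kk")
          case True
          then have "snd z / \<epsilon> \<ge> 4" using y0(2)[of z] \<epsilon> by (simp add: field_simps)
          then show ?thesis using m(5) by (simp add: h2_def)
        next
          case False
          then show ?thesis using Kk(3)[of z] True hs closure_subset by fastforce
        qed
        then show ?thesis using True hs by (simp add: u_def algebra_simps)
      qed
    qed simp
    also have "\<dots> = (LINT z:half_space|lborel. w z * h2 z)"
      unfolding set_lebesgue_integral_def
    proof (rule integral_completion)
      show "(\<lambda>z. indicator half_space z *\<^sub>R (w z * h2 z)) \<in> borel_measurable lborel"
        using borel_measurable_continuous_on_indicator[of half_space "\<lambda>z. w z * h2 z"]
          borel_open[OF open_half_space] wc continuous_on_subset[OF h2c, of half_space]
        by (auto intro!: continuous_intros)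
    qed
    finally show "\<bar>LINT z:half_space|lborel. w z * \<eta> z * (m' (snd z / \<epsilon>) / \<epsilon>)\<bar> \<le> \<delta>"
      by (simp add: h2_def mult.assoc)
  qed
qed

section \<open>A spline cutoff\<close>

text \<open>Truncated powers serve both as the building blocks of the spline cutoff and, composed
  with r^2 - |z|^2, as radial bumps with explicit derivatives. For exponent 0 the value is 1
  everywhere, also for negative arguments; hence the conditions \<open>k > 0\<close> below.\<close>

definition tpow :: "nat \<Rightarrow> real \<Rightarrow> real" where
  "tpow k t = (max 0 t) ^ k"

lemma tpow_nonneg: "0 \<le> tpow k t"
  by (simp add: tpow_def)

lemma tpow_eq_0: "k > 0 \<Longrightarrow> t \<le> 0 \<Longrightarrow> tpow k t = 0"
  by (simp add: tpow_def max_def zero_power)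

lemma tpow_eq_power: "0 \<le> t \<Longrightarrow> tpow k t = t ^ k"
  by (simp add: tpow_def)

lemma tpow_Suc: "k > 0 \<Longrightarrow> t * tpow k t = tpow (Suc k) t"
  by (cases "t \<le> 0") (simp_all add: tpow_eq_0 tpow_eq_power)

lemma continuous_on_tpow [continuous_intros]:
  "continuous_on S f \<Longrightarrow> continuous_on S (\<lambda>z. tpow k (f z))"
  unfolding tpow_def by (intro continuous_intros)

lemma DERIV_tpow:
  assumes "k \<ge> 2"
  shows "(tpow k has_real_derivative real k * tpow (k - 1) t) (at t)"
proof -
  consider "t > 0" | "t < 0" | "t = 0" by linarith
  then show ?thesis
  proof cases
    case 1
    have "\<forall>\<^sub>F x in nhds t. tpow k x = x ^ k"
      using eventually_nhds_in_open[of "{0<..}" t] 1 by (auto elim!: eventually_mono simp: tpow_eq_power)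
    moreover have "((\<lambda>x. x ^ k) has_real_derivative real k * tpow (k - 1) t) (at t)"
      using 1 by (auto intro!: derivative_eq_intros simp: tpow_eq_power)
    ultimately show ?thesis by (subst DERIV_cong_ev[OF refl _ refl])
  next
    case 2
    have "\<forall>\<^sub>F x in nhds t. tpow k x = 0"
      using eventually_nhds_in_open[of "{..<0}" t] 2 assms by (auto elim!: eventually_mono simp: tpow_eq_0)
    then show ?thesis using 2 assms DERIV_eventually_zero by (simp add: tpow_eq_0)
  next
    case 3
    have "isCont (tpow (k - 1)) 0"
      using continuous_on_tpow[OF continuous_on_id, of UNIV "k - 1"]
      by (simp add: continuous_on_eq_continuous_at)
    \<comment> \<open>Caratheodory's criterion at the corner: the slope function is
      \<open>tpow (k - 1)\<close> itself.\<close>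
    moreover have "tpow k z - tpow k 0 = tpow (k - 1) z * (z - 0)" for z
      using tpow_Suc[of "k - 1" z] assms by (simp add: tpow_eq_0 mult.commute)
    ultimately show ?thesis
      using assms 3 by (auto simp: CARAT_DERIV tpow_eq_0 intro!: exI[of _ "tpow (k - 1)"])
  qed
qed

text \<open>The antiderivative of the quadratic B-spline with knots 1, 2, 3, 4, and its derivatives.\<close>

definition step :: "real \<Rightarrow> real" where
  "step t = (tpow 3 (t - 1) - 3 * tpow 3 (t - 2) + 3 * tpow 3 (t - 3) - tpow 3 (t - 4)) / 6"

definition step' :: "real \<Rightarrow> real" where
  "step' t = (tpow 2 (t - 1) - 3 * tpow 2 (t - 2) + 3 * tpow 2 (t - 3) - tpow 2 (t - 4)) / 2"

definition step'' :: "real \<Rightarrow> real" where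
  "step'' t = tpow 1 (t - 1) - 3 * tpow 1 (t - 2) + 3 * tpow 1 (t - 3) - tpow 1 (t - 4)"

lemma DERIV_tpow_diff:
  "k \<ge> 2 \<Longrightarrow> ((\<lambda>t. tpow k (t - c)) has_real_derivative real k * tpow (k - 1) (t - c)) (at t)"
  using DERIV_shift[of "tpow k" "real k * tpow (k - 1) (t - c)" t "- c"] DERIV_tpow[of k "t - c"]
  by simp

lemma DERIV_sp: "(step has_real_derivative step' t) (at t)"
  unfolding step_def step'_def
  by (rule derivative_eq_intros DERIV_tpow_diff | simp)+

lemma DERIV_sp': "(step' has_real_derivative step'' t) (at t)"
  unfolding step'_def step''_def
  by (rule derivative_eq_intros DERIV_tpow_diff | simp)+

lemma step_le_1: "t \<le> 1 \<Longrightarrow> step t = 0" "t \<le> 1 \<Longrightarrow> step' t = 0" "t \<le> 1 \<Longrightarrow> step'' t = 0"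
  by (simp_all add: step_def step'_def step''_def tpow_eq_0)

lemma step_ge_4: "t \<ge> 4 \<Longrightarrow> step t = 1" "t \<ge> 4 \<Longrightarrow> step' t = 0" "t \<ge> 4 \<Longrightarrow> step'' t = 0"
  by (simp_all add: step_def step'_def step''_def tpow_eq_power power2_eq_square power3_eq_cube algebra_simps)

text \<open>Between the knots the spline consists of the arcs (t-1)^2/2, 3/4 - (t-5/2)^2 and
  (4-t)^2/2.\<close>

lemma step'_bounds: "0 \<le> step' t" "step' t \<le> 1"
proof -
  consider "t \<le> 1" | "1 \<le> t" "t \<le> 2" | "2 \<le> t" "t \<le> 3" | "3 \<le> t" "t \<le> 4" | "4 \<le> t" by linarith
  then have "0 \<le> step' t \<and> step' t \<le> 1"
  proof cases
    case 2
    then have "step' t = (t - 1)\<^sup>2 / 2" by (simp add: step'_def tpow_eq_0 tpow_eq_power)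
    moreover have "(t - 1)\<^sup>2 \<le> 1" using 2 by (simp add: power_le_one)
    ultimately show ?thesis using zero_le_power2[of "t - 1"] by linarith
  next
    case 3
    then have "step' t = ((t - 1)\<^sup>2 - 3 * (t - 2)\<^sup>2) / 2" by (simp add: step'_def tpow_eq_0 tpow_eq_power)
    also have "\<dots> = 1 / 2 + (t - 2) * (3 - t)" by (simp add: power2_eq_square field_simps)
    finally have "step' t = 1 / 2 + (t - 2) * (3 - t)" .
    moreover have "(t - 2) * (3 - t) \<le> 1 / 2"
      using zero_le_power2[of "2 * t - 5"] by (simp add: power2_eq_square algebra_simps)
    ultimately show ?thesis using 3 by simp
  next
    case 4
    then have "step' t = ((t - 1)\<^sup>2 - 3 * (t - 2)\<^sup>2 + 3 * (t - 3)\<^sup>2) / 2" by (simp add: step'_def tpow_eq_0 tpow_eq_power)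
    also have "\<dots> = (4 - t)\<^sup>2 / 2" by (simp add: power2_eq_square field_simps)
    finally have "step' t = (4 - t)\<^sup>2 / 2" .
    moreover have "(4 - t)\<^sup>2 \<le> 1" using 4 by (simp add: power_le_one)
    ultimately show ?thesis using zero_le_power2[of "4 - t"] by linarith
  qed (simp_all add: step_le_1 step_ge_4)
  then show "0 \<le> step' t" "step' t \<le> 1" by auto
qed

lemma step_mono: "x \<le> y \<Longrightarrow> step x \<le> step y"
  by (rule DERIV_nonneg_imp_nondecreasing) (use DERIV_sp step'_bounds in blast)+

lemma step_bounds: "0 \<le> step t" "step t \<le> 1"
proof -
  show "0 \<le> step t" using step_mono[of "min t 1" t] step_le_1(1)[of "min t 1"] by simp
  show "step t \<le> 1" using step_mono[of t "max t 4"] step_ge_4(1)[of "max t 4"] by simp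
qed

text \<open>A scale-invariant bound: with t = y/\<epsilon> it is uniform in \<epsilon>, as the
  dominated convergence for \<epsilon> tending to 0 requires.\<close>

lemma abs_mult_sp': "\<bar>t * step' t\<bar> \<le> 4"
proof (cases "1 \<le> t \<and> t \<le> 4")
  case True
  then show ?thesis using mult_mono[of "\<bar>t\<bar>" 4 "step' t" 1] step'_bounds[of t] by (simp add: abs_mult)
qed (use step_le_1[of t] step_ge_4[of t] in auto)

lemma continuous_on_sp [continuous_intros]:
  assumes "continuous_on S f"
  shows "continuous_on S (\<lambda>z. step (f z))" "continuous_on S (\<lambda>z. step' (f z))" "continuous_on S (\<lambda>z. step'' (f z))"
  unfolding step_def step'_def step''_def by (intro continuous_intros assms; simp)+

text \<open>If \<open>\<kappa> y = y powr (2\<gamma>) * step (y / \<epsilon>)\<close>, then \<open>y powr (1 - 2\<gamma>) * \<kappa>' y = cutoff \<gamma> (y / \<epsilon>)\<close>.\<close>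

definition cutoff :: "real \<Rightarrow> real \<Rightarrow> real" where
  "cutoff \<gamma> t = 2 * \<gamma> * step t + t * step' t"

definition cutoff' :: "real \<Rightarrow> real \<Rightarrow> real" where
  "cutoff' \<gamma> t = 2 * \<gamma> * step' t + step' t + t * step'' t"

lemma DERIV_cutoff: "(cutoff \<gamma> has_real_derivative cutoff' \<gamma> t) (at t)"
  unfolding cutoff_def cutoff'_def by (auto intro!: derivative_eq_intros DERIV_sp DERIV_sp')

lemma cutoff_le_1: "t \<le> 1 \<Longrightarrow> cutoff \<gamma> t = 0" "t \<le> 1 \<Longrightarrow> cutoff' \<gamma> t = 0"
  by (simp_all add: cutoff_def cutoff'_def step_le_1)

lemma cutoff_ge_4: "t \<ge> 4 \<Longrightarrow> cutoff \<gamma> t = 2 * \<gamma>" "t \<ge> 4 \<Longrightarrow> cutoff' \<gamma> t = 0"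
  by (simp_all add: cutoff_def cutoff'_def step_ge_4)

lemma abs_cutoff_le: "\<bar>cutoff \<gamma> t\<bar> \<le> 2 * \<bar>\<gamma>\<bar> + 4"
proof -
  have "\<bar>2 * \<gamma> * step t\<bar> \<le> 2 * \<bar>\<gamma>\<bar>" using mult_left_mono[OF step_bounds(2), of "2 * \<bar>\<gamma>\<bar>" t] step_bounds(1)[of t]
    by (simp add: abs_mult)
  then show ?thesis using abs_mult_sp'[of t] unfolding cutoff_def by linarith
qed

lemma continuous_on_cutoff [continuous_intros]:
  assumes "continuous_on S f"
  shows "continuous_on S (\<lambda>z. cutoff \<gamma> (f z))" "continuous_on S (\<lambda>z. cutoff' \<gamma> (f z))"
  unfolding cutoff_def cutoff'_def by (intro continuous_intros assms)+

section \<open>The degenerate elliptic equation\<close>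

lemma set_integrable_continuous_compact_support:
  fixes f :: "'a::euclidean_space \<Rightarrow> real"
  assumes S: "open S" and K: "compact K" "K \<subseteq> S" "\<And>z. z \<in> S - K \<Longrightarrow> f z = 0"
    and f: "continuous_on S f"
  shows "set_integrable lborel S f"
proof -
  have "integrable lborel (\<lambda>z. indicator K z *\<^sub>R f z)"
    by (intro borel_integrable_compact K continuous_on_subset[OF f])
  moreover have "(\<lambda>z. indicator K z *\<^sub>R f z) = (\<lambda>z. indicator S z *\<^sub>R f z)"
    using K by (auto simp: fun_eq_iff indicator_def)
  ultimately show ?thesis by (simp add: set_integrable_def)
qed

text \<open>Contraction with a Kronecker delta. Later sums over the coordinates keep their factors
  \<open>e \<bullet> b\<close> explicit so that this rule can collapse them.\<close>

lemma sum_Basis_component: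
  fixes e :: "'a::euclidean_space"
  assumes "e \<in> Basis"
  shows "(\<Sum>b\<in>Basis. (e \<bullet> b) * F b) = (F e :: real)"
proof -
  have "(\<Sum>b\<in>Basis. (e \<bullet> b) * F b) = (\<Sum>b\<in>Basis. if b = e then F b else 0)"
    using assms by (intro sum.cong) (auto simp: inner_Basis)
  then show ?thesis using assms by simp
qed

abbreviation vert :: "(real ^ 'n::finite) \<times> real" where
  "vert \<equiv> (0, 1)"

lemma vert_Basis: "vert \<in> Basis"
  by (simp add: Basis_prod_def)

lemma vert_inner: "vert \<bullet> z = snd z"
  by (simp add: inner_prod_def)

text \<open>\<open>W1\<close> and \<open>W2\<close> are the first and the pure second derivatives
  along the axes, tied to \<open>w\<close> through one-dimensional derivatives only. The assumption
  \<open>eq\<close> is div (y^a \<nabla>w) = 0 with a = 1 - 2\<gamma>, multiplied by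
  y^(1-a).\<close>

locale weighted_harmonic =
  fixes w :: "(real ^ 'n::finite) \<times> real \<Rightarrow> real"
    and W1 W2 :: "(real ^ 'n) \<times> real \<Rightarrow> (real ^ 'n) \<times> real \<Rightarrow> real"
    and \<gamma> :: real
  assumes \<gamma>: "0 < \<gamma>" "\<gamma> < 1"
    and contw: "continuous_on half_space w"
    and contW1: "\<And>b. b \<in> Basis \<Longrightarrow> continuous_on half_space (W1 b)"
    and contW2: "\<And>b. b \<in> Basis \<Longrightarrow> continuous_on half_space (W2 b)"
    and derw: "\<And>z b. z \<in> half_space \<Longrightarrow> b \<in> Basis \<Longrightarrow>
      ((\<lambda>t. w (z + t *\<^sub>R b)) has_real_derivative W1 b z) (at 0)"
    and derW1: "\<And>z b. z \<in> half_space \<Longrightarrow> b \<in> Basis \<Longrightarrow>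
      ((\<lambda>t. W1 b (z + t *\<^sub>R b)) has_real_derivative W2 b z) (at 0)"
    and eq: "\<And>z. z \<in> half_space \<Longrightarrow>
      snd z * (\<Sum>b\<in>Basis. W2 b z) + (1 - 2 * \<gamma>) * W1 vert z = 0"
    and trace: "w \<in> H1_tilde (1 - 2 * \<gamma>)"
begin

text \<open>Green's formula with weight y^a for \<open>w\<close> and \<kappa>\<eta>, where \<kappa>
  = y^(2\<gamma>) \<open>step\<close> (y/\<epsilon>). Because y^a \<kappa> = y \<open>step\<close>
  (y/\<epsilon>) and y^a \<kappa>' = \<open>cutoff \<gamma>\<close> (y/\<epsilon>), all real powers
  of y cancel and only splines and factors y remain.\<close>

lemma green_identity:
  fixes \<eta> :: "(real ^ 'n) \<times> real \<Rightarrow> real" and H1 H2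
  assumes cont: "continuous_on UNIV \<eta>" "\<And>b. b \<in> Basis \<Longrightarrow> continuous_on UNIV (H1 b)"
      "\<And>b. b \<in> Basis \<Longrightarrow> continuous_on UNIV (H2 b)"
    and der: "\<And>z b. b \<in> Basis \<Longrightarrow> ((\<lambda>t. \<eta> (z + t *\<^sub>R b)) has_real_derivative H1 b z) (at 0)"
      "\<And>z b. b \<in> Basis \<Longrightarrow> ((\<lambda>t. H1 b (z + t *\<^sub>R b)) has_real_derivative H2 b z) (at 0)"
    and supp: "\<And>z. norm z \<ge> R \<Longrightarrow> \<eta> z = 0" "\<And>z b. b \<in> Basis \<Longrightarrow> norm z \<ge> R \<Longrightarrow> H1 b z = 0"
      "\<And>z b. b \<in> Basis \<Longrightarrow> norm z \<ge> R \<Longrightarrow> H2 b z = 0"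
    and \<epsilon>: "\<epsilon> > 0"
  defines "q \<equiv> \<lambda>z::(real ^ 'n) \<times> real. snd z / \<epsilon>"
  shows "(LINT z:half_space|lborel.
      w z * ((step (q z) + q z * step' (q z) + cutoff \<gamma> (q z)) * H1 vert z + snd z * step (q z) * (\<Sum>b\<in>Basis. H2 b z))
      + w z * \<eta> z * (cutoff' \<gamma> (q z) / \<epsilon>)) = 0"
proof -
  \<comment> \<open>The flux y^a (w \<partial>_b (\<kappa>\<eta>) - \<kappa>\<eta> \<partial>_b
    w).\<close>
  define F where "F = (\<lambda>b z. w z * (snd z * step (q z) * H1 b z + (vert \<bullet> b) * (cutoff \<gamma> (q z) * \<eta> z))
     - \<eta> z * snd z * step (q z) * W1 b z)"
  \<comment> \<open>The derivative of \<open>F b\<close> along \<open>b\<close>, arranged by powers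
    of \<open>vert \<bullet> b\<close> so that the sum over \<open>b\<close> contracts term by
    term.\<close>
  define G where "G = (\<lambda>b z.
     (vert \<bullet> b) * (W1 b z * (cutoff \<gamma> (q z) * \<eta> z) + w z * (step (q z) * H1 b z + q z * step' (q z) * H1 b z
         + cutoff \<gamma> (q z) * H1 b z) - \<eta> z * step (q z) * W1 b z - \<eta> z * (q z * step' (q z)) * W1 b z)
     + (vert \<bullet> b) * ((vert \<bullet> b) * (w z * (cutoff' \<gamma> (q z) / \<epsilon>) * \<eta> z))
     + w z * (snd z * step (q z)) * H2 b z - \<eta> z * step (q z) * snd z * W2 b z)"
  define K where "K = cball 0 R \<inter> {z::(real ^ 'n) \<times> real. snd z \<ge> \<epsilon>}"
  have Kc: "compact K" unfolding K_def
    by (intro compact_Int_closed closed_Collect_le continuous_intros) auto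
  have KS: "K \<subseteq> half_space" using \<epsilon> by (auto simp: K_def half_space_def)
  have notK: "norm z \<ge> R \<or> q z \<le> 1" if "z \<notin> K" for z
    using that \<epsilon> by (auto simp: K_def q_def)
  have qc: "continuous_on S q" for S unfolding q_def using \<epsilon> by (intro continuous_intros) auto
  have c: "continuous_on half_space \<eta>" "\<And>b. b \<in> Basis \<Longrightarrow> continuous_on half_space (H1 b)"
      "\<And>b. b \<in> Basis \<Longrightarrow> continuous_on half_space (H2 b)"
    by (rule continuous_on_subset[OF _ subset_UNIV], rule cont, assumption?)+
  have F0: "F b z = 0" if "z \<in> half_space - K" "b \<in> Basis" for b z
    using notK[of z] that supp(1)[of z] supp(2,3)[of b z] by (auto simp: F_def step_le_1 cutoff_le_1)
  have G0: "G b z = 0" if "z \<in> half_space - K" "b \<in> Basis" for b z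
    using notK[of z] that supp(1)[of z] supp(2,3)[of b z] by (auto simp: G_def step_le_1 cutoff_le_1)
  have Fc: "continuous_on half_space (F b)" if "b \<in> Basis" for b
    unfolding F_def using that by (intro continuous_intros contw contW1 c qc)
  have Gc: "continuous_on half_space (G b)" if "b \<in> Basis" for b
    unfolding G_def using that \<epsilon> by (intro continuous_intros contw contW1 contW2 c qc) auto
  have FG: "((\<lambda>t. F b (z + t *\<^sub>R b)) has_real_derivative G b z) (at 0)" if z: "z \<in> half_space" and b: "b \<in> Basis" for b z
  proof -
    have ds: "((\<lambda>t. snd (z + t *\<^sub>R b)) has_real_derivative vert \<bullet> b) (at 0)"
      by (auto intro!: derivative_eq_intros simp: vert_inner)
    have dq: "((\<lambda>t. q (z + t *\<^sub>R b)) has_real_derivative (vert \<bullet> b) / \<epsilon>) (at 0)"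
      unfolding q_def by (rule DERIV_cdivide[OF ds])
    have dsp: "((\<lambda>t. step (q (z + t *\<^sub>R b))) has_real_derivative step' (q z) * ((vert \<bullet> b) / \<epsilon>)) (at 0)"
      using DERIV_chain2[OF DERIV_sp dq] by simp
    have dcut: "((\<lambda>t. cutoff \<gamma> (q (z + t *\<^sub>R b))) has_real_derivative cutoff' \<gamma> (q z) * ((vert \<bullet> b) / \<epsilon>)) (at 0)"
      using DERIV_chain2[OF DERIV_cutoff dq] by simp
    show ?thesis
      unfolding F_def
      by (rule derivative_eq_intros ds dsp dcut derw[OF z b] derW1[OF z b] der(1)[OF b] der(2)[OF b] refl)+
        (use \<epsilon> in \<open>simp add: G_def q_def field_simps\<close>)
  qed
  have "(LINT z:half_space|lborel. G b z) = 0" if "b \<in> Basis" for b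
    by (rule set_integral_directional_derivative_zero[OF open_half_space Kc KS F0 Fc Gc FG])
      (use that in auto)
  moreover have "(LINT z:half_space|lborel. (\<Sum>b\<in>Basis. G b z)) = (\<Sum>b\<in>Basis. LINT z:half_space|lborel. G b z)"
    unfolding set_lebesgue_integral_def scaleR_sum_right
    by (rule Bochner_Integration.integral_sum)
      (use set_integrable_continuous_compact_support[OF open_half_space Kc KS G0 Gc] in \<open>auto simp: set_integrable_def\<close>)
  ultimately have "(LINT z:half_space|lborel. (\<Sum>b\<in>Basis. G b z)) = 0" by simp
  moreover have "(\<Sum>b\<in>Basis. G b z) = 
      w z * ((step (q z) + q z * step' (q z) + cutoff \<gamma> (q z)) * H1 vert z + snd z * step (q z) * (\<Sum>b\<in>Basis. H2 b z))
      + w z * \<eta> z * (cutoff' \<gamma> (q z) / \<epsilon>)" if z: "z \<in> half_space" for z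
  proof -
    have "(\<Sum>b\<in>Basis. G b z) = (W1 vert z * (cutoff \<gamma> (q z) * \<eta> z) + w z * (step (q z) * H1 vert z + q z * step' (q z) * H1 vert z
         + cutoff \<gamma> (q z) * H1 vert z) - \<eta> z * step (q z) * W1 vert z - \<eta> z * (q z * step' (q z)) * W1 vert z)
       + w z * (cutoff' \<gamma> (q z) / \<epsilon>) * \<eta> z
     + w z * (snd z * step (q z)) * (\<Sum>b\<in>Basis. H2 b z) - \<eta> z * step (q z) * (snd z * (\<Sum>b\<in>Basis. W2 b z))"
      unfolding G_def sum.distrib sum_subtractf sum_Basis_component[OF vert_Basis]
      by (simp add: vert_inner sum_distrib_left mult.assoc)
    also have "snd z * (\<Sum>b\<in>Basis. W2 b z) = - ((1 - 2 * \<gamma>) * W1 vert z)" using eq[OF z] by linarith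
    finally show ?thesis by (simp add: cutoff_def algebra_simps)
  qed
  ultimately show ?thesis
    using set_lebesgue_integral_cong[of half_space lborel "\<lambda>z. \<Sum>b\<in>Basis. G b z"] borel_open[OF open_half_space]
    by (smt (verit) sets_lborel)
qed

end

lemma has_derivative_imp_directional:
  fixes f :: "'a::real_normed_vector \<Rightarrow> real"
  assumes "(f has_derivative f') (at z)"
  shows "((\<lambda>t. f (z + t *\<^sub>R b)) has_real_derivative f' b) (at 0)"
proof -
  have f: "(f has_derivative f') (at (z + 0 *\<^sub>R b))" using assms by simp
  have "((\<lambda>t. z + t *\<^sub>R b) has_derivative (\<lambda>t. t *\<^sub>R b)) (at 0)"
    by (auto intro!: derivative_eq_intros)
  from has_derivative_compose[OF this f]
  have "((\<lambda>t. f (z + t *\<^sub>R b)) has_derivative (\<lambda>t. f' (t *\<^sub>R b))) (at 0)" .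
  moreover have "(\<lambda>t. f' (t *\<^sub>R b)) = (*) (f' b)"
    using linear_cmul[OF has_derivative_linear[OF assms], of _ b] by (auto simp: mult.commute)
  ultimately show ?thesis by (simp add: has_field_derivative_def)
qed

lemma has_derivative_bump:
  fixes c :: "'a::euclidean_space"
  assumes "k \<ge> 2"
  shows "((\<lambda>z. tpow k (r\<^sup>2 - (norm (z - c))\<^sup>2)) has_derivative
     (\<lambda>h. ((- 2 * real k * tpow (k - 1) (r\<^sup>2 - (norm (z - c))\<^sup>2)) *\<^sub>R (z - c)) \<bullet> h)) (at z)"
proof -
  have d: "((\<lambda>z. r\<^sup>2 - (norm (z - c))\<^sup>2) has_derivative (\<lambda>h. - 2 * ((z - c) \<bullet> h))) (at z)"
    unfolding power2_norm_eq_inner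
    by (rule derivative_eq_intros refl)+ (auto simp: fun_eq_iff inner_commute)
  have "(tpow k has_derivative (*) (real k * tpow (k - 1) (r\<^sup>2 - (norm (z - c))\<^sup>2))) (at (r\<^sup>2 - (norm (z - c))\<^sup>2))"
    using DERIV_tpow[OF assms] by (simp add: has_field_derivative_def)
  from has_derivative_compose[OF d this] show ?thesis
    by (rule has_derivative_eq_rhs) (auto simp: fun_eq_iff algebra_simps)
qed

text \<open>The set where \<open>f\<close> is nonzero is open and null, hence empty.\<close>

lemma set_integral_zero_imp_zero:
  fixes f :: "'a::euclidean_space \<Rightarrow> real"
  assumes S: "open S" and f: "continuous_on S f" "\<And>z. z \<in> S \<Longrightarrow> 0 \<le> f z" "set_integrable lborel S f"
    and 0: "(LINT z:S|lborel. f z) = 0" and z: "z \<in> S"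
  shows "f z = 0"
proof -
  have "AE z in lborel. indicator S z *\<^sub>R f z = 0"
    using 0 f integral_nonneg_eq_0_iff_AE[of lborel "\<lambda>z. indicator S z *\<^sub>R f z"]
    unfolding set_lebesgue_integral_def set_integrable_def
    by (auto simp: indicator_def)
  then have "AE z in lborel. z \<notin> {z \<in> S. f z \<noteq> 0}" by eventually_elim auto
  moreover have op: "open {z \<in> S. f z \<noteq> 0}"
  proof -
    have "open (S \<inter> f -` (- {0}))" using S f(1) by (intro continuous_open_preimage) auto
    also have "S \<inter> f -` (- {0}) = {z \<in> S. f z \<noteq> 0}" by auto
    finally show ?thesis .
  qed
  ultimately have "{z \<in> S. f z \<noteq> 0} \<in> null_sets lborel"
    by (subst AE_iff_null_sets) auto
  then have "negligible {z \<in> S. f z \<noteq> 0}"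
    by (simp add: negligible_iff_null_sets null_sets_completionI)
  then have "{z \<in> S. f z \<noteq> 0} = {}" using op open_not_negligible by blast
  then show ?thesis using z by auto
qed

section \<open>The equation tested up to the boundary\<close>

context weighted_harmonic
begin

text \<open>This is \<open>green_identity\<close> in the limit \<epsilon> to 0, where
  \<open>step\<close> becomes 1 and \<open>cutoff \<gamma>\<close> becomes 2\<gamma>. The bulk part
  \<open>A\<close> converges by domination, for which \<open>w\<close> has to be bounded; the layer
  part \<open>L\<close> tends to 0 by the trace condition.\<close>

lemma weak_equation:
  fixes \<eta> :: "(real ^ 'n) \<times> real \<Rightarrow> real" and P H2
  assumes P: "\<And>z. (\<eta> has_derivative (\<lambda>h. P z \<bullet> h)) (at z)" "continuous_on UNIV P"
    and H2: "\<And>b. b \<in> Basis \<Longrightarrow> continuous_on UNIV (H2 b)"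
      "\<And>z b. b \<in> Basis \<Longrightarrow> ((\<lambda>t. P (z + t *\<^sub>R b) \<bullet> b) has_real_derivative H2 b z) (at 0)"
    and supp: "\<And>z. norm z \<ge> R \<Longrightarrow> \<eta> z = 0" "\<And>z. norm z \<ge> R \<Longrightarrow> P z = 0"
      "\<And>z b. b \<in> Basis \<Longrightarrow> norm z \<ge> R \<Longrightarrow> H2 b z = 0"
    and R: "R > 0"
    and w1: "\<And>z. z \<in> half_space \<Longrightarrow> \<bar>w z\<bar> \<le> 1"
  shows "(LINT z:half_space|lborel. w z * ((1 + 2 * \<gamma>) * (P z \<bullet> vert) + snd z * (\<Sum>b\<in>Basis. H2 b z))) = 0"
proof -
  define S where "S = (half_space :: ((real ^ 'n) \<times> real) set)"
  define g where "g = (\<lambda>z. w z * ((1 + 2 * \<gamma>) * (P z \<bullet> vert) + snd z * (\<Sum>b\<in>Basis. H2 b z)))"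
  define \<epsilon> where "\<epsilon> = (\<lambda>i. inverse (real (Suc i)))"
  have \<epsilon>: "0 < \<epsilon> i" for i unfolding \<epsilon>_def by simp
  have \<epsilon>lim: "\<epsilon> \<longlonglongrightarrow> 0" unfolding \<epsilon>_def by (rule LIMSEQ_inverse_real_of_nat)
  define q where "q = (\<lambda>i (z::(real ^ 'n) \<times> real). snd z / \<epsilon> i)"
  define A where "A = (\<lambda>i z. w z * ((step (q i z) + q i z * step' (q i z) + cutoff \<gamma> (q i z)) * (P z \<bullet> vert)
      + snd z * step (q i z) * (\<Sum>b\<in>Basis. H2 b z)))"
  define L where "L = (\<lambda>i z. w z * \<eta> z * (cutoff' \<gamma> (q i z) / \<epsilon> i))"
  have \<eta>c: "continuous_on UNIV \<eta>"
    using P(1) by (meson continuous_at_imp_continuous_on has_derivative_continuous)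
  have Pdir: "((\<lambda>t. \<eta> (z + t *\<^sub>R b)) has_real_derivative P z \<bullet> b) (at 0)" for z b
    by (rule has_derivative_imp_directional[OF P(1)])
  have qc: "continuous_on T (q i)" for T i unfolding q_def using \<epsilon>[of i] by (intro continuous_intros) auto
  have c: "continuous_on S \<eta>" "continuous_on S P" "\<And>b. b \<in> Basis \<Longrightarrow> continuous_on S (H2 b)"
    by (rule continuous_on_subset[OF _ subset_UNIV], rule \<eta>c P H2, assumption?)+
  have wc: "continuous_on S w" unfolding S_def by (rule contw)
  have Ac: "continuous_on S (A i)" for i
    unfolding A_def by (intro continuous_intros wc c qc)
  have Lc: "continuous_on S (L i)" for i
    unfolding L_def using \<epsilon>[of i] by (intro continuous_intros wc c qc) auto
  have gc: "continuous_on S g"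
    unfolding g_def by (intro continuous_intros wc c)
  have oS: "open S" unfolding S_def by (rule open_half_space)
  define K where "K = (\<lambda>i. cball 0 R \<inter> {z::(real ^ 'n) \<times> real. snd z \<ge> \<epsilon> i})"
  have Kc: "compact (K i)" for i unfolding K_def
    by (intro compact_Int_closed closed_Collect_le continuous_intros) auto
  have KS: "K i \<subseteq> S" for i using \<epsilon>[of i] by (auto simp: K_def half_space_def S_def)
  have notK: "norm z \<ge> R \<or> q i z \<le> 1" if "z \<notin> K i" for z i
    using that \<epsilon>[of i] by (auto simp: K_def q_def)
  have sum0: "(\<Sum>b\<in>Basis. H2 b z) = 0" if "norm z \<ge> R" for z
    using that by (intro sum.neutral) (simp add: supp(3))
  have A0: "A i z = 0" if "z \<in> S - K i" for i z
    using notK[of z i] that supp(2)[of z] sum0[of z] by (auto simp: A_def step_le_1 cutoff_le_1)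
  have L0: "L i z = 0" if "z \<in> S - K i" for i z
    using notK[of z i] that supp(1)[of z] by (auto simp: L_def step_le_1 cutoff_le_1)
  note Ai = set_integrable_continuous_compact_support[OF oS Kc KS A0 Ac]
  note Li = set_integrable_continuous_compact_support[OF oS Kc KS L0 Lc]
  have AL: "(LINT z:S|lborel. A i z) = - (LINT z:S|lborel. L i z)" for i
  proof -
    have "(LINT z:S|lborel. A i z + L i z) = 0"
      unfolding A_def L_def q_def S_def
      by (rule green_identity[where R = R]) (use \<eta>c P H2 supp \<epsilon> Pdir in \<open>auto intro!: continuous_intros\<close>)
    then show ?thesis using set_integral_add(2)[OF Ai[of i] Li[of i]] by simp
  qed
  have Llim: "(\<lambda>i. LINT z:S|lborel. L i z) \<longlonglongrightarrow> 0"
  proof (rule LIMSEQ_I)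
    fix d :: real assume d: "d > 0"
    obtain \<epsilon>0 where \<epsilon>0: "\<epsilon>0 > 0"
       "\<And>\<epsilon>. 0 < \<epsilon> \<Longrightarrow> \<epsilon> < \<epsilon>0 \<Longrightarrow>
        \<bar>LINT z:half_space|lborel. w z * \<eta> z * (cutoff' \<gamma> (snd z / \<epsilon>) / \<epsilon>)\<bar> \<le> d / 2"
    proof (rule zero_trace_layer_integral[OF _ trace contw P supp(1,2) DERIV_cutoff _ cutoff_le_1 cutoff_ge_4(2) abs_cutoff_le _ R, of \<gamma> "d / 2"])
      show "continuous_on UNIV (cutoff' \<gamma>)" by (intro continuous_intros)
    qed (use \<gamma> d in auto)
    have "\<forall>\<^sub>F i in sequentially. \<epsilon> i < \<epsilon>0" using \<epsilon>lim \<epsilon>0(1) by (rule order_tendstoD)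
    then obtain N where N: "\<And>i. i \<ge> N \<Longrightarrow> \<epsilon> i < \<epsilon>0" unfolding eventually_sequentially by auto
    have "norm ((LINT z:S|lborel. L i z) - 0) < d" if "i \<ge> N" for i
      using \<epsilon>0(2)[OF \<epsilon> N[OF that]] d
      unfolding L_def S_def q_def real_norm_def diff_0_right by linarith
    then show "\<exists>N. \<forall>i\<ge>N. norm ((LINT z:S|lborel. L i z) - 0) < d" by blast
  qed
  obtain M1 where M1: "\<And>z. norm (P z) \<le> M1" "M1 \<ge> 0"
    using compact_support_bounded[OF P(2) supp(2)] by metis
  obtain M2 where M2: "\<And>z. norm (\<Sum>b\<in>Basis. H2 b z) \<le> M2" "M2 \<ge> 0"
  proof (rule compact_support_bounded[of "\<lambda>z. \<Sum>b\<in>Basis. H2 b z" R])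
    show "continuous_on UNIV (\<lambda>z. \<Sum>b\<in>Basis. H2 b z)" by (intro continuous_intros H2)
  qed (use supp in auto)
  \<comment> \<open>The three summands bound \<open>step q\<close>, \<open>q * step' q\<close> and
    \<open>cutoff \<gamma> q\<close>; on the support of \<open>\<eta>\<close> the height is at most
    \<open>R\<close>.\<close>
  define M where "M = (1 + 4 + (2 * \<gamma> + 4)) * M1 + R * M2"
  have "(\<lambda>i. integral\<^sup>L lborel (\<lambda>z. indicator S z *\<^sub>R A i z)) \<longlonglongrightarrow> integral\<^sup>L lborel (\<lambda>z. indicator S z *\<^sub>R g z)"
  proof (rule integral_dominated_convergence[where w = "\<lambda>z. M * indicator (cball 0 R) z"])
    show "(\<lambda>z. indicator S z *\<^sub>R g z) \<in> borel_measurable lborel"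
      using borel_measurable_continuous_on_indicator[OF borel_open[OF oS] gc] by simp
    show "(\<lambda>z. indicator S z *\<^sub>R A i z) \<in> borel_measurable lborel" for i
      using borel_measurable_continuous_on_indicator[OF borel_open[OF oS] Ac] by simp
    show "integrable lborel (\<lambda>z. M * indicator (cball 0 R) z :: real)"
      using emeasure_compact_finite[of "cball 0 R"]
      by (intro integrable_mult_right integrable_real_indicator) auto
    show "AE z in lborel. (\<lambda>i. indicator S z *\<^sub>R A i z) \<longlonglongrightarrow> indicator S z *\<^sub>R g z"
    proof (rule AE_I2)
      fix z :: "(real ^ 'n) \<times> real"
      show "(\<lambda>i. indicator S z *\<^sub>R A i z) \<longlonglongrightarrow> indicator S z *\<^sub>R g z"
      proof (cases "z \<in> S")
        case True
        then have y: "snd z > 0" by (simp add: S_def half_space_def)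
        \<comment> \<open>Once 4\<epsilon> is below the height of \<open>z\<close>, the cutoffs have
          reached their final values there, so the sequence is eventually constant.\<close>
        have "\<forall>\<^sub>F i in sequentially. \<epsilon> i < snd z / 4" using \<epsilon>lim y by (intro order_tendstoD) auto
        then have "\<forall>\<^sub>F i in sequentially. indicator S z *\<^sub>R A i z = indicator S z *\<^sub>R g z"
        proof eventually_elim
          case (elim i)
          then have "q i z \<ge> 4" using \<epsilon>[of i] by (simp add: q_def field_simps)
          then show ?case by (simp add: A_def g_def step_ge_4 cutoff_ge_4)
        qed
        then show ?thesis by (rule tendsto_eventually)
      qed simp
    qed
    show "AE z in lborel. norm (indicator S z *\<^sub>R A i z) \<le> M * indicator (cball 0 R) z" for i
    proof (rule AE_I2)
      fix z :: "(real ^ 'n) \<times> real"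
      show "norm (indicator S z *\<^sub>R A i z) \<le> M * indicator (cball 0 R) z"
      proof (cases "z \<in> S \<and> norm z \<le> R")
        case True
        then have y: "snd z > 0" "z \<in> half_space" by (auto simp: S_def half_space_def)
        have yR: "\<bar>snd z\<bar> \<le> R" using True norm_snd_le[of "snd z" "fst z"] by simp
        have Pv: "\<bar>P z \<bullet> vert\<bar> \<le> M1"
          using Cauchy_Schwarz_ineq2[of "P z" vert] M1(1)[of z] by (simp add: norm_Pair)
        have 1: "\<bar>step (q i z) + q i z * step' (q i z) + cutoff \<gamma> (q i z)\<bar> \<le> 1 + 4 + (2 * \<gamma> + 4)"
          using step_bounds[of "q i z"] abs_mult_sp'[of "q i z"] abs_cutoff_le[of \<gamma> "q i z"] \<gamma> by linarith
        have 2: "\<bar>snd z * step (q i z)\<bar> \<le> R"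
          using mult_mono[OF yR step_bounds(2)] step_bounds[of "q i z"] R by (simp add: abs_mult)
        have "\<bar>(step (q i z) + q i z * step' (q i z) + cutoff \<gamma> (q i z)) * (P z \<bullet> vert)
           + snd z * step (q i z) * (\<Sum>b\<in>Basis. H2 b z)\<bar>
          \<le> \<bar>step (q i z) + q i z * step' (q i z) + cutoff \<gamma> (q i z)\<bar> * \<bar>P z \<bullet> vert\<bar>
           + \<bar>snd z * step (q i z)\<bar> * \<bar>\<Sum>b\<in>Basis. H2 b z\<bar>"
          unfolding abs_mult[symmetric] by (rule abs_triangle_ineq)
        also have "\<dots> \<le> M"
          unfolding M_def using 1 2 Pv M2(1)[of z] \<gamma> R by (intro add_mono mult_mono) auto
        finally have "\<bar>A i z\<bar> \<le> 1 * M" unfolding A_def abs_mult[of "w z"]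
          using w1[OF y(2)] by (intro mult_mono) auto
        then show ?thesis using True by simp
      next
        case False
        then have "indicator S z *\<^sub>R A i z = 0"
          using supp(2)[of z] sum0[of z] by (cases "z \<in> S") (auto simp: A_def)
        moreover have "M \<ge> 0" unfolding M_def using M1 M2 R \<gamma> by auto
        ultimately show ?thesis by (simp only: norm_zero mult_nonneg_nonneg indicator_pos_le)
      qed
    qed
  qed
  then have "(\<lambda>i. LINT z:S|lborel. A i z) \<longlonglongrightarrow> (LINT z:S|lborel. g z)"
    by (simp add: set_lebesgue_integral_def)
  moreover have "(\<lambda>i. LINT z:S|lborel. A i z) \<longlonglongrightarrow> 0"
    using tendsto_minus[OF Llim] by (simp add: AL)
  ultimately show ?thesis unfolding g_def S_def using LIMSEQ_unique by blast
qed

end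

section \<open>Nonnegativity from vertical monotonicity\<close>

context weighted_harmonic
begin

text \<open>A negative value at \<open>z0\<close> propagates down the vertical lines, so
  \<open>w\<close> is below -c on a whole half-ball at the foot of \<open>z0\<close>, which is
  incompatible with trace zero. To quantify this, a bump \<eta> at the foot is used: the layer
  integrals of \<open>w * \<eta>\<close> are at most -c times those of \<eta>, and the latter stay
  above a positive constant.\<close>

lemma vertically_monotone_nonneg:
  assumes mono: "\<And>z. z \<in> half_space \<Longrightarrow> 0 \<le> W1 vert z" and z0: "z0 \<in> half_space"
  shows "0 \<le> w z0"
proof (rule ccontr)
  assume "\<not> 0 \<le> w z0"
  define c where "c = - w z0 / 2"
  have c: "c > 0" using \<open>\<not> 0 \<le> w z0\<close> by (simp add: c_def)
  have y0: "snd z0 > 0" using z0 by (simp add: half_space_def)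
  obtain d where d: "d > 0" "\<And>z. dist z z0 < d \<Longrightarrow> w z \<le> - c"
  proof -
    have "isCont w z0"
      using contw z0 continuous_on_eq_continuous_at[OF open_half_space] by blast
    then obtain d where "d > 0" "\<And>z. dist z z0 < d \<Longrightarrow> dist (w z) (w z0) < c"
      using c unfolding continuous_at_eps_delta by blast
    then show ?thesis using that[of d] by (force simp: c_def dist_real_def abs_if split: if_splits)
  qed
  \<comment> \<open>The bound by \<open>snd z0\<close> keeps the half-ball of radius \<delta> at the
    foot below the height of \<open>z0\<close>, so that monotonicity can be applied upwards to that
    height.\<close>
  define \<delta> where "\<delta> = min d (snd z0)"
  have \<delta>: "\<delta> > 0" "\<delta> \<le> d" "\<delta> \<le> snd z0" using d y0 by (auto simp: \<delta>_def)
  define c0 :: "(real ^ 'n) \<times> real" where "c0 = (fst z0, 0)"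
  have vmono: "w (x, y) \<le> w (x, y')" if "0 < y" "y \<le> y'" for x :: "real ^ 'n" and y y'
  proof (rule DERIV_nonneg_imp_nondecreasing[OF that(2)])
    fix t assume t: "y \<le> t" "t \<le> y'"
    have z: "(x, t) \<in> half_space" using that t by (simp add: half_space_def)
    have "((\<lambda>s. w (x, s + t)) has_real_derivative W1 vert (x, t)) (at 0)"
      using derw[OF z vert_Basis] by (simp add: add.commute)
    then have "((\<lambda>s. w (x, s)) has_real_derivative W1 vert (x, t)) (at t)"
      using DERIV_shift[of "\<lambda>s. w (x, s)" "W1 vert (x, t)" 0 t] by simp
    then show "\<exists>l. ((\<lambda>s. w (x, s)) has_real_derivative l) (at t) \<and> 0 \<le> l" using mono[OF z] by blast
  qed
  have wneg: "w z \<le> - c" if z: "z \<in> half_space" "norm (z - c0) < \<delta>" for z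
  proof -
    have "norm (fst (z - c0)) \<le> norm (z - c0)" "\<bar>snd (z - c0)\<bar> \<le> norm (z - c0)"
      using norm_fst_le[of "fst (z - c0)" "snd (z - c0)"] norm_snd_le[of "snd (z - c0)" "fst (z - c0)"]
      unfolding prod.collapse real_norm_def .
    then have n: "norm (fst z - fst z0) < \<delta>" "\<bar>snd z\<bar> < \<delta>" using z by (auto simp: c0_def)
    have "w z = w (fst z, snd z)" by simp
    also have "\<dots> \<le> w (fst z, snd z0)"
      by (rule vmono) (use z n \<delta> in \<open>auto simp: half_space_def\<close>)
    also have "dist (fst z, snd z0) z0 < d"
      using n(1) \<delta> by (cases z0) (simp add: dist_Pair_Pair dist_norm)
    then have "w (fst z, snd z0) \<le> - c" by (rule d(2))
    finally show ?thesis by simp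
  qed
  define \<eta> where "\<eta> = (\<lambda>z. tpow 2 (\<delta>\<^sup>2 - (norm (z - c0))\<^sup>2))"
  define P where "P = (\<lambda>z. (- 2 * real 2 * tpow (2 - 1) (\<delta>\<^sup>2 - (norm (z - c0))\<^sup>2)) *\<^sub>R (z - c0))"
  define R where "R = norm c0 + \<delta>"
  have R: "R > 0" using \<delta> by (simp add: R_def add_nonneg_pos)
  have der: "(\<eta> has_derivative (\<lambda>h. P z \<bullet> h)) (at z)" for z
    unfolding \<eta>_def P_def by (rule has_derivative_bump) simp
  have Pc: "continuous_on T P" and \<eta>c: "continuous_on T \<eta>" for T
    unfolding P_def \<eta>_def by (intro continuous_intros)+
  have far: "\<delta>\<^sup>2 - (norm (z - c0))\<^sup>2 \<le> 0" if "\<delta> \<le> norm (z - c0)" for z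
    using that \<delta> by (simp add: power_mono)
  have supp: "\<eta> z = 0" "P z = 0" if "R \<le> norm z" for z
  proof -
    have "\<delta> \<le> norm (z - c0)" using that norm_triangle_ineq2[of z c0] by (simp add: R_def)
    then show "\<eta> z = 0" "P z = 0" using far[of z] by (simp_all add: \<eta>_def P_def tpow_eq_0)
  qed
  define J where "J = (\<lambda>\<epsilon>. LINT z:half_space|lborel. \<eta> z * (step' (snd z / \<epsilon>) / \<epsilon>))"
  define L where "L = (\<lambda>\<epsilon>. LINT z:half_space|lborel. w z * \<eta> z * (step' (snd z / \<epsilon>) / \<epsilon>))"
  \<comment> \<open>Vertical integration by parts turns the layer integral
    \<open>J \<epsilon>\<close> into the integral of \<open>Q \<epsilon>\<close>. The bump decreases
    upwards, so \<open>Q \<epsilon>\<close> is nonnegative and grows as \<epsilon> decreases; this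
    bounds \<open>J\<close> from below.\<close>
  define Q where "Q = (\<lambda>\<epsilon> z. - (P z \<bullet> vert) * step (snd z / \<epsilon>))"
  define K where "K = (\<lambda>\<epsilon>. cball 0 R \<inter> {z::(real ^ 'n) \<times> real. snd z \<ge> \<epsilon>})"
  have Kc: "compact (K \<epsilon>)" for \<epsilon> unfolding K_def
    by (intro compact_Int_closed closed_Collect_le continuous_intros) auto
  have KS: "K \<epsilon> \<subseteq> half_space" if "\<epsilon> > 0" for \<epsilon> using that by (auto simp: K_def half_space_def)
  have notK: "\<eta> z = 0 \<and> P z = 0 \<or> step (snd z / \<epsilon>) = 0 \<and> step' (snd z / \<epsilon>) = 0" if "z \<notin> K \<epsilon>" "\<epsilon> > 0" for z \<epsilon>
    using that supp[of z] step_le_1[of "snd z / \<epsilon>"] by (auto simp: K_def)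
  have Z: "Q \<epsilon> z = 0" "\<eta> z * (step' (snd z / \<epsilon>) / \<epsilon>) = 0" "w z * \<eta> z * (step' (snd z / \<epsilon>) / \<epsilon>) = 0"
    "\<eta> z * step (snd z / \<epsilon>) = 0"
    if "z \<in> half_space - K \<epsilon>" "\<epsilon> > 0" for z \<epsilon>
    using notK[of z \<epsilon>] that by (auto simp: Q_def)
  have c': "continuous_on half_space (Q \<epsilon>)" "continuous_on half_space (\<lambda>z. \<eta> z * (step' (snd z / \<epsilon>) / \<epsilon>))"
    "continuous_on half_space (\<lambda>z. w z * \<eta> z * (step' (snd z / \<epsilon>) / \<epsilon>))"
    "continuous_on half_space (\<lambda>z. \<eta> z * step (snd z / \<epsilon>))" if "\<epsilon> > 0" for \<epsilon>
    unfolding Q_def using that by (intro continuous_intros contw Pc \<eta>c; simp)+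
  have Qi: "set_integrable lborel half_space (Q \<epsilon>)" if "\<epsilon> > 0" for \<epsilon>
    by (rule set_integrable_continuous_compact_support[OF open_half_space Kc KS Z(1) c'(1)]) (simp_all add: that)
  have Ji: "set_integrable lborel half_space (\<lambda>z. \<eta> z * (step' (snd z / \<epsilon>) / \<epsilon>))" if "\<epsilon> > 0" for \<epsilon>
    by (rule set_integrable_continuous_compact_support[OF open_half_space Kc KS Z(2) c'(2)]) (simp_all add: that)
  have Li: "set_integrable lborel half_space (\<lambda>z. w z * \<eta> z * (step' (snd z / \<epsilon>) / \<epsilon>))" if "\<epsilon> > 0" for \<epsilon>
    by (rule set_integrable_continuous_compact_support[OF open_half_space Kc KS Z(3) c'(3)]) (simp_all add: that)
  have JQ: "J \<epsilon> = (LINT z:half_space|lborel. Q \<epsilon> z)" if e: "\<epsilon> > 0" for \<epsilon>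
  proof -
    have "(LINT z:half_space|lborel. \<eta> z * (step' (snd z / \<epsilon>) / \<epsilon>) - Q \<epsilon> z) = 0"
    proof (rule set_integral_directional_derivative_zero[OF open_half_space Kc KS[OF e],
        where f = "\<lambda>z. \<eta> z * step (snd z / \<epsilon>)" and b = vert])
      show "\<eta> z * step (snd z / \<epsilon>) = 0" if "z \<in> half_space - K \<epsilon>" for z
        by (rule Z(4)[OF that e])
      show "continuous_on half_space (\<lambda>z. \<eta> z * step (snd z / \<epsilon>))"
        by (rule c'(4)[OF e])
      show "continuous_on half_space (\<lambda>z. \<eta> z * (step' (snd z / \<epsilon>) / \<epsilon>) - Q \<epsilon> z)"
        by (intro continuous_intros c'(1,2)[OF e])
      fix z :: "(real ^ 'n) \<times> real"
      have dq: "((\<lambda>t. snd (z + t *\<^sub>R vert) / \<epsilon>) has_real_derivative 1 / \<epsilon>) (at 0)"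
        using e by (auto intro!: derivative_eq_intros)
      have "((\<lambda>t. step (snd (z + t *\<^sub>R vert) / \<epsilon>)) has_real_derivative step' (snd z / \<epsilon>) * (1 / \<epsilon>)) (at 0)"
        using DERIV_chain2[OF DERIV_sp dq] by simp
      from DERIV_mult[OF has_derivative_imp_directional[OF der] this]
      show "((\<lambda>t. \<eta> (z + t *\<^sub>R vert) * step (snd (z + t *\<^sub>R vert) / \<epsilon>)) has_real_derivative
          \<eta> z * (step' (snd z / \<epsilon>) / \<epsilon>) - Q \<epsilon> z) (at 0)"
        by (rule DERIV_cong) (simp add: Q_def zero_prod_def[symmetric])
    qed
    then show ?thesis using set_integral_diff(2)[OF Ji[OF e] Qi[OF e]] by (simp add: J_def)
  qed
  have Pv: "- (P z \<bullet> vert) = 4 * tpow 1 (\<delta>\<^sup>2 - (norm (z - c0))\<^sup>2) * snd z" for z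
    by (simp add: P_def inner_prod_def c0_def)
  have Q0: "0 \<le> Q \<epsilon> z" if "z \<in> half_space" for z \<epsilon>
    unfolding Q_def Pv using that step_bounds tpow_nonneg by (auto simp: half_space_def)
  \<comment> \<open>With this value the point \<open>z1\<close> at height \<delta>/2 has argument 4,
    where \<open>step\<close> is already 1.\<close>
  define \<epsilon>1 where "\<epsilon>1 = \<delta> / 8"
  have \<epsilon>1: "\<epsilon>1 > 0" using \<delta> by (simp add: \<epsilon>1_def)
  have Jmono: "J \<epsilon>1 \<le> J \<epsilon>" if e: "0 < \<epsilon>" "\<epsilon> \<le> \<epsilon>1" for \<epsilon>
    unfolding JQ[OF e(1)] JQ[OF \<epsilon>1]
  proof (rule set_integral_mono[OF Qi[OF \<epsilon>1] Qi[OF e(1)]])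
    fix z :: "(real ^ 'n) \<times> real" assume z: "z \<in> half_space"
    have "snd z / \<epsilon>1 \<le> snd z / \<epsilon>" using z e by (intro divide_left_mono) (auto simp: half_space_def)
    then show "Q \<epsilon>1 z \<le> Q \<epsilon> z"
      unfolding Q_def Pv using z tpow_nonneg
      by (intro mult_left_mono step_mono) (auto simp: half_space_def)
  qed
  have Jpos: "J \<epsilon>1 > 0"
  proof -
    define z1 where "z1 = c0 + (\<delta> / 2) *\<^sub>R vert"
    have z1: "z1 \<in> half_space" "snd z1 = \<delta> / 2" "norm (z1 - c0) = \<delta> / 2"
      using \<delta> by (auto simp: z1_def c0_def half_space_def norm_Pair)
    have "Q \<epsilon>1 z1 > 0"
    proof -
      have "step (snd z1 / \<epsilon>1) = 1" using \<delta> by (intro step_ge_4) (simp add: z1 \<epsilon>1_def)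
      moreover have "tpow 1 (\<delta>\<^sup>2 - (\<delta> / 2)\<^sup>2) > 0" using \<delta> by (simp add: tpow_def power2_eq_square)
      ultimately show ?thesis unfolding Q_def Pv z1 using \<delta> by (simp add: z1)
    qed
    moreover have "continuous_on half_space (Q \<epsilon>1)"
      by (rule c'(1)[OF \<epsilon>1])
    ultimately have "J \<epsilon>1 \<noteq> 0"
      using set_integral_zero_imp_zero[OF open_half_space _ Q0 Qi[OF \<epsilon>1] _ z1(1)] unfolding JQ[OF \<epsilon>1] by fastforce
    moreover have "0 \<le> J \<epsilon>1" unfolding JQ[OF \<epsilon>1] set_lebesgue_integral_def
      by (rule integral_nonneg_AE) (auto simp: indicator_def Q0)
    ultimately show ?thesis by simp
  qed
  have LJ: "L \<epsilon> \<le> - c * J \<epsilon>" if e: "0 < \<epsilon>" for \<epsilon>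
  proof -
    have "- c * J \<epsilon> = (LINT z:half_space|lborel. - c * (\<eta> z * (step' (snd z / \<epsilon>) / \<epsilon>)))"
      unfolding J_def by (rule set_integral_mult_right[symmetric])
    moreover have "L \<epsilon> \<le> (LINT z:half_space|lborel. - c * (\<eta> z * (step' (snd z / \<epsilon>) / \<epsilon>)))"
      unfolding L_def
    proof (rule set_integral_mono[OF Li[OF e]])
      show "set_integrable lborel half_space (\<lambda>z. - c * (\<eta> z * (step' (snd z / \<epsilon>) / \<epsilon>)))"
        by (intro set_integrable_mult_right Ji e)
      fix z :: "(real ^ 'n) \<times> real" assume z: "z \<in> half_space"
      have "w z * \<eta> z \<le> - c * \<eta> z"
      proof (cases "norm (z - c0) < \<delta>")
        case True
        then show ?thesis using wneg[OF z] by (intro mult_right_mono) (auto simp: \<eta>_def tpow_nonneg)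
      next
        case False
        then show ?thesis using far[of z] by (simp add: \<eta>_def tpow_eq_0)
      qed
      then have "w z * \<eta> z * (step' (snd z / \<epsilon>) / \<epsilon>) \<le> - c * \<eta> z * (step' (snd z / \<epsilon>) / \<epsilon>)"
        by (rule mult_right_mono) (use step'_bounds e in auto)
      then show "w z * \<eta> z * (step' (snd z / \<epsilon>) / \<epsilon>) \<le> - c * (\<eta> z * (step' (snd z / \<epsilon>) / \<epsilon>))"
        by (simp only: mult.assoc)
    qed
    ultimately show ?thesis by simp
  qed
  have cJ: "c * J \<epsilon>1 / 2 > 0" using c Jpos by simp
  obtain \<epsilon>0 where \<epsilon>0: "\<epsilon>0 > 0"
       "\<And>\<epsilon>. 0 < \<epsilon> \<Longrightarrow> \<epsilon> < \<epsilon>0 \<Longrightarrow>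
        \<bar>LINT z:half_space|lborel. w z * \<eta> z * (step' (snd z / \<epsilon>) / \<epsilon>)\<bar> \<le> c * J \<epsilon>1 / 2"
  proof (rule zero_trace_layer_integral[OF _ trace contw der Pc supp DERIV_sp _ step_le_1(1,2) step_ge_4(2) _ _ R, of 1 "c * J \<epsilon>1 / 2"])
    show "continuous_on UNIV step'" by (intro continuous_intros)
    show "\<bar>step t\<bar> \<le> 1" for t using step_bounds[of t] by simp
  qed (use \<gamma> cJ in auto)
  define \<epsilon> where "\<epsilon> = min (\<epsilon>0 / 2) \<epsilon>1"
  have \<epsilon>: "0 < \<epsilon>" "\<epsilon> < \<epsilon>0" "\<epsilon> \<le> \<epsilon>1" using \<epsilon>0 \<epsilon>1 by (auto simp: \<epsilon>_def)
  have "- (c * J \<epsilon>1 / 2) \<le> L \<epsilon>" using \<epsilon>0(2)[OF \<epsilon>(1,2)] unfolding L_def by linarith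
  also have "L \<epsilon> \<le> - c * J \<epsilon>" by (rule LJ[OF \<epsilon>(1)])
  also have "\<dots> \<le> - c * J \<epsilon>1" using Jmono[OF \<epsilon>(1,3)] c by simp
  finally show False using c Jpos mult_pos_pos[OF c Jpos] by linarith
qed

end

section \<open>Moments of radial weights\<close>

context weighted_harmonic
begin

text \<open>These weights close up under the operator of \<open>weak_equation\<close>: applied to
  the bump of index k + 2 it gives a combination of the weights of index k + 1 and k at the same
  radius.\<close>

definition moment :: "nat \<Rightarrow> real \<Rightarrow> real" where
  "moment k r = (LINT z:half_space|lborel. w z * snd z * tpow k (r\<^sup>2 - (norm z)\<^sup>2))"

context
  assumes w01: "\<And>z. z \<in> half_space \<Longrightarrow> 0 \<le> w z" "\<And>z. z \<in> half_space \<Longrightarrow> w z \<le> 1"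
begin

lemma moment_bound:
  assumes k: "k > 0" and r: "r > 0" and z: "z \<in> half_space"
  shows "\<bar>w z * snd z * tpow k (r\<^sup>2 - (norm z)\<^sup>2)\<bar> \<le> r * (r\<^sup>2) ^ k * indicator (cball 0 r) z"
proof (cases "norm z \<le> r")
  case True
  have "\<bar>snd z\<bar> \<le> r" using norm_snd_le[of "snd z" "fst z"] True by simp
  moreover have "\<bar>w z\<bar> \<le> 1" using w01[OF z] by simp
  moreover have "\<bar>tpow k (r\<^sup>2 - (norm z)\<^sup>2)\<bar> \<le> (r\<^sup>2) ^ k"
    using True by (auto simp: tpow_def intro!: power_mono)
  ultimately have "\<bar>w z\<bar> * \<bar>snd z\<bar> * \<bar>tpow k (r\<^sup>2 - (norm z)\<^sup>2)\<bar> \<le> (1 * r) * (r\<^sup>2) ^ k"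
    using r by (intro mult_mono) auto
  then show ?thesis using True by (simp add: abs_mult)
next
  case False
  then have "r\<^sup>2 - (norm z)\<^sup>2 \<le> 0" using r by (simp add: power_mono)
  then show ?thesis using k r by (simp add: tpow_eq_0)
qed

lemma set_integrable_moment:
  assumes k: "k > 0" and r: "r > 0"
  shows "set_integrable lborel half_space (\<lambda>z. w z * snd z * tpow k (r\<^sup>2 - (norm z)\<^sup>2))"
  unfolding set_integrable_def
proof (rule Bochner_Integration.integrable_bound)
  show "integrable lborel (\<lambda>z. r * (r\<^sup>2) ^ k * indicator (cball 0 r) z :: real)"
    using emeasure_compact_finite[of "cball 0 r"]
    by (intro integrable_mult_right integrable_real_indicator) auto
  have "continuous_on half_space (\<lambda>z. w z * snd z * tpow k (r\<^sup>2 - (norm z)\<^sup>2))"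
    by (intro continuous_intros contw)
  from borel_measurable_continuous_on_indicator[OF borel_open[OF open_half_space] this]
  show "(\<lambda>z. indicator half_space z *\<^sub>R (w z * snd z * tpow k (r\<^sup>2 - (norm z)\<^sup>2))) \<in> borel_measurable lborel"
    by simp
  show "AE z in lborel. norm (indicator half_space z *\<^sub>R (w z * snd z * tpow k (r\<^sup>2 - (norm z)\<^sup>2)))
      \<le> norm (r * (r\<^sup>2) ^ k * indicator (cball 0 r) z :: real)"
  proof (rule AE_I2)
    fix z :: "(real ^ 'n) \<times> real"
    have "0 \<le> r * (r\<^sup>2) ^ k * indicator (cball 0 r) z" using r by simp
    then show "norm (indicator half_space z *\<^sub>R (w z * snd z * tpow k (r\<^sup>2 - (norm z)\<^sup>2)))
      \<le> norm (r * (r\<^sup>2) ^ k * indicator (cball 0 r) z :: real)"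
      using moment_bound[OF k r, of z] by (cases "z \<in> half_space") auto
  qed
qed

text \<open>The height contributes r, the bump r^2 and the volume r^(n+1).\<close>

lemma moment_1_le:
  assumes r: "r > 0"
  shows "moment 1 r \<le> unit_ball_vol (real (CARD('n) + 1)) * r ^ (CARD('n) + 4)"
proof -
  have "moment 1 r \<le> (LINT z|lborel. r * (r\<^sup>2) ^ 1 * indicator (cball 0 r) (z :: (real ^ 'n) \<times> real))"
    unfolding moment_def set_lebesgue_integral_def
  proof (rule integral_mono)
    show "integrable lborel (\<lambda>z. indicator half_space z *\<^sub>R (w z * snd z * tpow 1 (r\<^sup>2 - (norm z)\<^sup>2)))"
      using set_integrable_moment[of 1 r] r by (simp add: set_integrable_def)
    show "integrable lborel (\<lambda>z::(real ^ 'n) \<times> real. r * (r\<^sup>2) ^ 1 * indicator (cball 0 r) z :: real)"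
      using emeasure_compact_finite[of "cball (0::(real ^ 'n) \<times> real) r"]
      by (intro integrable_mult_right integrable_real_indicator) auto
    fix z :: "(real ^ 'n) \<times> real"
    show "indicator half_space z *\<^sub>R (w z * snd z * tpow 1 (r\<^sup>2 - (norm z)\<^sup>2)) \<le> r * (r\<^sup>2) ^ 1 * indicator (cball 0 r) z"
      using moment_bound[of 1 r z] r by (cases "z \<in> half_space") auto
  qed
  also have "\<dots> = r ^ 3 * measure lborel (cball (0::(real ^ 'n) \<times> real) r)"
    by (simp add: power2_eq_square power3_eq_cube)
  also have "\<dots> = unit_ball_vol (real (CARD('n) + 1)) * r ^ (CARD('n) + 4)"
    using r by (simp add: content_cball power_add power3_eq_cube power4_eq_xxxx)
  finally show ?thesis .
qed

text \<open>The second-order operator of \<open>weak_equation\<close> acts on radial functions as the radial Laplacian in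
  the fractional dimension \<open>n + 2 + 2\<gamma>\<close>.\<close>

lemma moment_Suc:
  assumes j: "j > 0" and r: "r > 0"
  defines "\<alpha> \<equiv> (real CARD('n) + 2 + 2 * \<gamma>) / 2"
  shows "(\<alpha> + real (Suc j)) * moment (Suc j) r = real (Suc j) * r\<^sup>2 * moment j r"
proof -
  \<comment> \<open>The test function has index j + 2, which two derivatives lower to j. As j > 0,
    the second derivatives are continuous and vanish outside the ball.\<close>
  define k where "k = Suc (Suc j)"
  have k: "k \<ge> 3" "k - 1 = Suc j" "k - 2 = j" using j by (auto simp: k_def)
  define h where "h = (\<lambda>z::(real ^ 'n) \<times> real. r\<^sup>2 - (norm z)\<^sup>2)"
  define P where "P = (\<lambda>z. (- 2 * real k * tpow (k - 1) (h z)) *\<^sub>R z)"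
  define H2 where "H2 = (\<lambda>b z. - 2 * real k * tpow (k - 1) (h z)
     + 4 * real k * real (k - 1) * tpow (k - 2) (h z) * ((z \<bullet> b) * (z \<bullet> b)))"
  have far: "h z \<le> 0" if "r \<le> norm z" for z using that r by (simp add: h_def power_mono)
  have "(LINT z:half_space|lborel. w z * ((1 + 2 * \<gamma>) * (P z \<bullet> vert) + snd z * (\<Sum>b\<in>Basis. H2 b z))) = 0"
  proof (rule weak_equation[where R = r and \<eta> = "\<lambda>z. tpow k (h z)"])
    show "((\<lambda>z. tpow k (h z)) has_derivative (\<lambda>d. P z \<bullet> d)) (at z)" for z
      using has_derivative_bump[of k r 0 z] k by (simp add: h_def P_def)
    show "continuous_on UNIV P" unfolding P_def h_def by (intro continuous_intros)
    show "continuous_on UNIV (H2 b)" for b unfolding H2_def h_def by (intro continuous_intros)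
    show "((\<lambda>t. P (z + t *\<^sub>R b) \<bullet> b) has_real_derivative H2 b z) (at 0)" if b: "b \<in> Basis" for z b
    proof -
      have bb: "b \<bullet> b = 1" using b by simp
      have "((\<lambda>t. tpow (k - 1) (h (z + t *\<^sub>R b))) has_real_derivative
          ((- 2 * real (k - 1) * tpow (k - 2) (h z)) *\<^sub>R z) \<bullet> b) (at 0)"
        using has_derivative_imp_directional[OF has_derivative_bump[of "Suc j" r 0 z], of b] j
        unfolding k(2,3) by (simp add: h_def)
      moreover have "((\<lambda>t. (z + t *\<^sub>R b) \<bullet> b) has_real_derivative 1) (at 0)"
        by (auto intro!: derivative_eq_intros simp: inner_add_left bb)
      ultimately have "((\<lambda>t. - 2 * real k * (tpow (k - 1) (h (z + t *\<^sub>R b)) * ((z + t *\<^sub>R b) \<bullet> b))) has_real_derivative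
         - 2 * real k * (((- 2 * real (k - 1) * tpow (k - 2) (h z)) *\<^sub>R z) \<bullet> b * ((z + 0 *\<^sub>R b) \<bullet> b)
             + 1 * tpow (k - 1) (h (z + 0 *\<^sub>R b)))) (at 0)"
        by (intro DERIV_cmult DERIV_mult)
      then show ?thesis
        by (simp add: P_def H2_def algebra_simps)
    qed
    show "tpow k (h z) = 0" "P z = 0" if "r \<le> norm z" for z
      using far[OF that] k by (simp_all add: tpow_eq_0 P_def)
    show "H2 b z = 0" if "r \<le> norm z" for z b
      using far[OF that] k j by (simp add: tpow_eq_0 H2_def)
    show "\<bar>w z\<bar> \<le> 1" if "z \<in> half_space" for z using w01[OF that] by simp
  qed (rule r)
  also have "(\<lambda>z. w z * ((1 + 2 * \<gamma>) * (P z \<bullet> vert) + snd z * (\<Sum>b\<in>Basis. H2 b z)))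
    = (\<lambda>z. 4 * real k * (real (k - 1) * r\<^sup>2) * (w z * snd z * tpow j (h z))
         - 4 * real k * (\<alpha> + real (k - 1)) * (w z * snd z * tpow (Suc j) (h z)))"
  proof
    fix z :: "(real ^ 'n) \<times> real"
    have "(\<Sum>b\<in>Basis. H2 b z) = (real CARD('n) + 1) * (- 2 * real k * tpow (k - 1) (h z))
       + 4 * real k * real (k - 1) * tpow (k - 2) (h z) * (norm z)\<^sup>2"
      unfolding H2_def sum.distrib sum_distrib_left[symmetric] euclidean_inner[symmetric]
      by (simp add: power2_norm_eq_inner)
    \<comment> \<open>Writing |z|^2 = r^2 - h turns the factor |z|^2 into a shift of the
      index.\<close>
    moreover have "tpow j (h z) * (norm z)\<^sup>2 = r\<^sup>2 * tpow j (h z) - tpow (Suc j) (h z)"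
      using tpow_Suc[OF j, of "h z"] by (simp add: h_def algebra_simps)
    ultimately have S: "(\<Sum>b\<in>Basis. H2 b z) = (real CARD('n) + 1) * (- 2 * real k * tpow (Suc j) (h z))
       + 4 * real k * real (k - 1) * (r\<^sup>2 * tpow j (h z) - tpow (Suc j) (h z))"
      unfolding k(2,3) by (simp only: mult.assoc)
    have Pv: "P z \<bullet> vert = - 2 * real k * tpow (Suc j) (h z) * snd z"
      unfolding P_def k(2) by (simp add: inner_prod_def)
    show "w z * ((1 + 2 * \<gamma>) * (P z \<bullet> vert) + snd z * (\<Sum>b\<in>Basis. H2 b z))
      = 4 * real k * (real (k - 1) * r\<^sup>2) * (w z * snd z * tpow j (h z))
         - 4 * real k * (\<alpha> + real (k - 1)) * (w z * snd z * tpow (Suc j) (h z))"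
      unfolding S Pv by (simp add: \<alpha>_def field_simps)
  qed
  also have "(LINT z:half_space|lborel. 4 * real k * (real (k - 1) * r\<^sup>2) * (w z * snd z * tpow j (h z))
         - 4 * real k * (\<alpha> + real (k - 1)) * (w z * snd z * tpow (Suc j) (h z)))
     = 4 * real k * (real (k - 1) * r\<^sup>2) * moment j r - 4 * real k * (\<alpha> + real (k - 1)) * moment (Suc j) r"
    unfolding moment_def h_def
    by (subst set_integral_diff(2))
      (use set_integrable_moment[OF _ r] j in \<open>simp_all only: set_integral_mult_right set_integrable_mult_right zero_less_Suc\<close>)
  finally show ?thesis unfolding k(2) using k(1) by (simp add: mult.assoc)
qed

text \<open>The recursion iterated from index 1; the factor \<alpha> (\<alpha> + 1) is the
  Pochhammer symbol at the start. In this form \<open>fact k\<close> over the Pochhammer symbol is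
  the quotient in \<open>Gamma_series\<close>.\<close>

lemma moment_pochhammer:
  assumes k: "k > 0" and r: "r > 0"
  defines "\<alpha> \<equiv> (real CARD('n) + 2 + 2 * \<gamma>) / 2"
  shows "moment k r * pochhammer \<alpha> (Suc k) = \<alpha> * (\<alpha> + 1) * (r\<^sup>2) ^ (k - 1) * fact k * moment 1 r"
  using k
proof (induction k rule: nat_induct_non_zero)
  case 1
  then show ?case by (simp add: pochhammer_Suc)
next
  case (Suc k)
  have "moment (Suc k) r * pochhammer \<alpha> (Suc (Suc k))
     = ((\<alpha> + real (Suc k)) * moment (Suc k) r) * pochhammer \<alpha> (Suc k)"
    by (simp add: pochhammer_Suc[of _ "Suc k"])
  also have "\<dots> = real (Suc k) * r\<^sup>2 * (moment k r * pochhammer \<alpha> (Suc k))"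
    unfolding \<alpha>_def moment_Suc[OF Suc.hyps r] by (simp only: mult_ac)
  also have "\<dots> = \<alpha> * (\<alpha> + 1) * (r\<^sup>2) ^ (Suc k - 1) * fact (Suc k) * moment 1 r"
    unfolding Suc.IH using Suc.hyps by (cases k) (simp_all add: field_simps)
  finally show ?case .
qed

text \<open>On the ball of radius \<open>r\<close> the weight of index \<open>k\<close> at radius
  sqrt k is at least (k - r^2)^k, and the weight of index 1 is at most r^2. After division by k^k
  the lower bound tends to exp(-r^2), so high moments at growing radius still see a fixed
  ball.\<close>

lemma moment_lower:
  assumes "r\<^sup>2 \<le> real k" "k > 0" "r > 0"
  shows "(real k - r\<^sup>2) ^ k * moment 1 r \<le> r\<^sup>2 * moment k (sqrt (real k))"
proof -
  have "(LINT z:half_space|lborel. (real k - r\<^sup>2) ^ k * (w z * snd z * tpow 1 (r\<^sup>2 - (norm z)\<^sup>2)))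
    \<le> (LINT z:half_space|lborel. r\<^sup>2 * (w z * snd z * tpow k ((sqrt (real k))\<^sup>2 - (norm z)\<^sup>2)))"
  proof (rule set_integral_mono)
    fix z :: "(real ^ 'n) \<times> real" assume z: "z \<in> half_space"
    have "(real k - r\<^sup>2) ^ k * tpow 1 (r\<^sup>2 - (norm z)\<^sup>2) \<le> r\<^sup>2 * tpow k ((sqrt (real k))\<^sup>2 - (norm z)\<^sup>2)"
    proof (cases "norm z \<le> r")
      case True
      then have n: "(norm z)\<^sup>2 \<le> r\<^sup>2" by (simp add: power_mono)
      then have C: "0 \<le> real k - (norm z)\<^sup>2" using assms by linarith
      from n have A: "(real k - r\<^sup>2) ^ k \<le> (real k - (norm z)\<^sup>2) ^ k" using assms by (intro power_mono) auto
      have B: "tpow 1 (r\<^sup>2 - (norm z)\<^sup>2) \<le> r\<^sup>2" using n by (simp add: tpow_def)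
      have "(real k - r\<^sup>2) ^ k * tpow 1 (r\<^sup>2 - (norm z)\<^sup>2) \<le> (real k - (norm z)\<^sup>2) ^ k * r\<^sup>2"
        by (rule mult_mono[OF A B]) (use zero_le_power[OF C] in \<open>simp_all add: tpow_nonneg\<close>)
      then show ?thesis using assms by (simp add: tpow_eq_power[OF C] mult.commute)
    next
      case False
      then have "r\<^sup>2 - (norm z)\<^sup>2 \<le> 0" using assms by (simp add: power_mono)
      then show ?thesis by (simp add: tpow_eq_0 tpow_nonneg)
    qed
    then have "w z * snd z * ((real k - r\<^sup>2) ^ k * tpow 1 (r\<^sup>2 - (norm z)\<^sup>2))
      \<le> w z * snd z * (r\<^sup>2 * tpow k ((sqrt (real k))\<^sup>2 - (norm z)\<^sup>2))"
      by (rule mult_left_mono) (use w01[OF z] z in \<open>auto simp: half_space_def\<close>)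
    then show "(real k - r\<^sup>2) ^ k * (w z * snd z * tpow 1 (r\<^sup>2 - (norm z)\<^sup>2))
      \<le> r\<^sup>2 * (w z * snd z * tpow k ((sqrt (real k))\<^sup>2 - (norm z)\<^sup>2))"
      by (simp only: mult_ac)
  qed (intro set_integrable_mult_right set_integrable_moment; use assms in simp)+
  then show ?thesis by (simp only: moment_def set_integral_mult_right)
qed

end

end

section \<open>Vanishing of bounded nonnegative solutions\<close>

context weighted_harmonic
begin

lemma bounded_nonneg_eq_0:
  assumes w01: "\<And>z. z \<in> half_space \<Longrightarrow> 0 \<le> w z" "\<And>z. z \<in> half_space \<Longrightarrow> w z \<le> 1"
    and z: "z \<in> half_space"
  shows "w z = 0"
proof -
  define \<alpha> where "\<alpha> = (real CARD('n) + 2 + 2 * \<gamma>) / 2"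
  have \<alpha>: "\<alpha> > 0" using \<gamma> by (simp add: \<alpha>_def)
  define V where "V = unit_ball_vol (real (CARD('n) + 1))"
  \<comment> \<open>Any radius beyond |z| makes the weight positive at \<open>z\<close>.\<close>
  define r where "r = norm z + 1"
  have r: "r > 0" "norm z < r" by (auto simp: r_def add_nonneg_pos)
  define X where "X = moment 1 r"
  define c where "c = r\<^sup>2 * V * \<alpha> * (\<alpha> + 1)"
  have V: "V \<ge> 0" by (simp add: V_def)
  \<comment> \<open>Count of exponents of k, after division by k^k: -1 from k^(k-1), (n+4)/2 from
    \<open>moment_1_le\<close> at radius sqrt k, and -\<alpha> from the Gamma series. Their sum is
    -\<gamma>.\<close>
  have ineq: "(1 + (- r\<^sup>2) / real k) ^ k * X \<le> c * Gamma_series \<alpha> k * real k powr (- \<gamma>)"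
    if k: "k > 0" "r\<^sup>2 \<le> real k" for k
  proof -
    define p where "p = pochhammer \<alpha> (Suc k)"
    have p: "p > 0" unfolding p_def by (rule pochhammer_pos[OF \<alpha>])
    have sk: "sqrt (real k) > 0" using k by simp
    have "(real k - r\<^sup>2) ^ k * X \<le> r\<^sup>2 * moment k (sqrt (real k))"
      unfolding X_def by (rule moment_lower[OF w01]) (use k r in auto)
    then have "(real k - r\<^sup>2) ^ k * X * p \<le> r\<^sup>2 * (moment k (sqrt (real k)) * p)"
      using p by (simp add: mult.assoc[symmetric] mult_right_mono)
    also have "moment k (sqrt (real k)) * p
       = \<alpha> * (\<alpha> + 1) * real k ^ (k - 1) * fact k * moment 1 (sqrt (real k))"
      using moment_pochhammer[OF w01 k(1) sk] by (simp add: p_def \<alpha>_def)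
    also have "\<dots> \<le> \<alpha> * (\<alpha> + 1) * real k ^ (k - 1) * fact k * (V * sqrt (real k) ^ (CARD('n) + 4))"
      unfolding V_def using \<alpha> by (intro mult_left_mono moment_1_le[OF w01 sk]) auto
    finally have "(real k - r\<^sup>2) ^ k * X * p
       \<le> r\<^sup>2 * (\<alpha> * (\<alpha> + 1) * real k ^ (k - 1) * fact k * (V * sqrt (real k) ^ (CARD('n) + 4)))"
      using r by (simp add: mult_left_mono)
    then have "(real k - r\<^sup>2) ^ k * X
      \<le> r\<^sup>2 * (\<alpha> * (\<alpha> + 1) * real k ^ (k - 1) * fact k * (V * sqrt (real k) ^ (CARD('n) + 4))) / p"
      using p by (simp add: pos_le_divide_eq)
    also have "\<dots> = c * (fact k / p) * (real k ^ (k - 1) * sqrt (real k) ^ (CARD('n) + 4))"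
      by (simp add: c_def)
    also have "fact k / p = Gamma_series \<alpha> k * real k powr (- \<alpha>)"
      using k by (simp add: Gamma_series_def p_def powr_def exp_minus field_simps)
    also have "real k ^ (k - 1) * sqrt (real k) ^ (CARD('n) + 4)
       = real k ^ k * real k powr ((real CARD('n) + 2) / 2)"
    proof -
      have "sqrt (real k) ^ (CARD('n) + 4) = (real k powr (1/2)) powr (real (CARD('n) + 4))"
        using k by (simp add: powr_half_sqrt powr_realpow del: of_nat_add)
      also have "\<dots> = real k powr (1 + (real CARD('n) + 2) / 2)"
        unfolding powr_powr by (simp add: field_simps)
      also have "\<dots> = real k * real k powr ((real CARD('n) + 2) / 2)"
        using k by (simp add: powr_add)
      finally show ?thesis using k by (cases k) simp_all
    qed
    also have "c * (Gamma_series \<alpha> k * real k powr (- \<alpha>)) * (real k ^ k * real k powr ((real CARD('n) + 2) / 2))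
      = real k ^ k * (c * Gamma_series \<alpha> k * (real k powr (- \<alpha>) * real k powr ((real CARD('n) + 2) / 2)))"
      by (simp only: mult_ac)
    also have "real k powr (- \<alpha>) * real k powr ((real CARD('n) + 2) / 2) = real k powr (- \<gamma>)"
      unfolding powr_add[symmetric] by (simp add: \<alpha>_def field_simps)
    finally have *: "(real k - r\<^sup>2) ^ k * X \<le> real k ^ k * (c * Gamma_series \<alpha> k * real k powr (- \<gamma>))" .
    have "real k - r\<^sup>2 = real k * (1 + (- r\<^sup>2) / real k)" using k by (simp add: field_simps)
    then have "(real k - r\<^sup>2) ^ k = real k ^ k * (1 + (- r\<^sup>2) / real k) ^ k"
      by (metis power_mult_distrib)
    with * show ?thesis using k by (simp add: mult.assoc)
  qed
  \<comment> \<open>As k tends to infinity the Gamma series converges, so the right-hand side of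
    \<open>ineq\<close> vanishes in the limit.\<close>
  have "X * exp (- r\<^sup>2) \<le> 0"
  proof (rule tendsto_le[OF sequentially_bot])
    have "(\<lambda>k. c * Gamma_series \<alpha> k * real k powr (- \<gamma>)) \<longlonglongrightarrow> c * Gamma \<alpha> * 0"
      using \<gamma> by (intro tendsto_mult tendsto_const Gamma_series_LIMSEQ
          tendsto_neg_powr filterlim_real_sequentially) auto
    then show "(\<lambda>k. c * Gamma_series \<alpha> k * real k powr (- \<gamma>)) \<longlonglongrightarrow> 0" by simp
    show "(\<lambda>k. X * (1 + (- r\<^sup>2) / real k) ^ k) \<longlonglongrightarrow> X * exp (- r\<^sup>2)"
      by (intro tendsto_mult tendsto_const tendsto_exp_limit_sequentially)
    show "\<forall>\<^sub>F k in sequentially. X * (1 + (- r\<^sup>2) / real k) ^ k \<le> c * Gamma_series \<alpha> k * real k powr (- \<gamma>)"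
      using eventually_gt_at_top[of 0] eventually_ge_at_top[of "nat \<lceil>r\<^sup>2\<rceil>"]
    proof eventually_elim
      case (elim k)
      then have "r\<^sup>2 \<le> real k" by linarith
      then show ?case using ineq[of k] elim by (simp only: mult.commute[of X])
    qed
  qed
  then have "X \<le> 0" by (simp add: mult_le_0_iff)
  have nonneg: "0 \<le> w x * snd x * tpow 1 (r\<^sup>2 - (norm x)\<^sup>2)" if "x \<in> half_space" for x
    using w01(1)[OF that] that tpow_nonneg by (auto simp: half_space_def)
  then have "X \<ge> 0"
    unfolding X_def moment_def set_lebesgue_integral_def
    by (intro integral_nonneg_AE) (auto simp: indicator_def)
  with \<open>X \<le> 0\<close> have X: "(LINT x:half_space|lborel. w x * snd x * tpow 1 (r\<^sup>2 - (norm x)\<^sup>2)) = 0"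
    by (simp add: X_def moment_def)
  have "w z * snd z * tpow 1 (r\<^sup>2 - (norm z)\<^sup>2) = 0"
    using nonneg set_integrable_moment[OF w01 _ r(1), of 1]
    by (intro set_integral_zero_imp_zero[OF open_half_space _ _ _ X z]) (auto intro!: continuous_intros contw)
  moreover have "tpow 1 (r\<^sup>2 - (norm z)\<^sup>2) > 0"
    using r by (simp add: tpow_def power_strict_mono)
  ultimately show ?thesis using z by (simp add: half_space_def)
qed

end

section \<open>Conformally flat metrics\<close>

lemma differentiable_imp_directional:
  "f differentiable (at z) \<Longrightarrow>
    ((\<lambda>t. f (z + t *\<^sub>R b)) has_real_derivative partial_deriv b f z) (at 0)"
  unfolding partial_deriv_def frechet_derivative_works by (rule has_derivative_imp_directional)

lemma partial_deriv_eqI: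
  assumes "f differentiable (at z)" "((\<lambda>t. f (z + t *\<^sub>R b)) has_real_derivative d) (at 0)"
  shows "partial_deriv b f z = d"
  using DERIV_unique[OF differentiable_imp_directional[OF assms(1)] assms(2)] .

lemma partial_deriv_cong_open:
  assumes "open S" "z \<in> S" "\<And>x. x \<in> S \<Longrightarrow> f x = h x" "h differentiable (at z)"
  shows "partial_deriv b f z = partial_deriv b h z"
  unfolding partial_deriv_def
  using frechet_derivative_transform_within_open[OF assms(4,1,2)] assms(3) by metis

text \<open>The definite description in \<open>sharp\<close> is resolved by exhibiting a
  representing vector; any other one has the same components because \<open>c\<close> is
  nonzero.\<close>

lemma sharp_conformal:
  fixes c :: real and \<alpha> :: "'a::euclidean_space \<Rightarrow> real"
  assumes g: "\<And>p q. g z p q = c * (p \<bullet> q)" and c: "c \<noteq> 0" and \<alpha>: "linear \<alpha>"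
  shows "sharp g z \<alpha> = (1 / c) *\<^sub>R (\<Sum>b\<in>Basis. \<alpha> b *\<^sub>R b)"
proof -
  define v where "v = (1 / c) *\<^sub>R (\<Sum>b\<in>Basis. \<alpha> b *\<^sub>R b)"
  have v: "g z v w = \<alpha> w" for w
  proof -
    have "\<alpha> w = \<alpha> (\<Sum>b\<in>Basis. (w \<bullet> b) *\<^sub>R b)" by (simp add: euclidean_representation)
    also have "\<dots> = (\<Sum>b\<in>Basis. (w \<bullet> b) * \<alpha> b)"
      using \<alpha> by (simp add: linear_sum linear_cmul)
    finally show ?thesis
      using c by (simp add: g v_def inner_sum_left inner_sum_right inner_commute mult.commute)
  qed
  have "u = v" if "\<forall>w. g z u w = \<alpha> w" for u
  proof (rule euclidean_eqI)
    fix b :: 'a assume "b \<in> Basis"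
    have "c * (u \<bullet> b) = c * (v \<bullet> b)" using that v by (simp add: g)
    then show "u \<bullet> b = v \<bullet> b" using c by simp
  qed
  with v show ?thesis unfolding sharp_def v_def[symmetric] by (intro the_equality) auto
qed

lemma grad_conformal:
  assumes "\<And>p q. g z p q = c * (p \<bullet> q)" "c \<noteq> 0" "u differentiable (at z)"
  shows "grad g u z = (1 / c) *\<^sub>R (\<Sum>b\<in>Basis. partial_deriv b u z *\<^sub>R b)"
  unfolding grad_def partial_deriv_def
  using assms by (intro sharp_conformal linear_frechet_derivative) auto

lemma inv_metric_conformal:
  assumes "\<And>p q. g z p q = c * (p \<bullet> q)" "c \<noteq> 0"
  shows "inv_metric g z i j = (i \<bullet> j) / c"
proof -
  have "linear (\<lambda>w. w \<bullet> i)" by (intro linearI) (auto simp: inner_add_left)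
  then show ?thesis
    unfolding inv_metric_def using assms
    by (subst sharp_conformal[of g z c]) (auto simp: inner_commute[of _ i] euclidean_representation)
qed

text \<open>A permutation other than the identity moves some basis vector, and the corresponding
  off-diagonal entry is a zero factor.\<close>

lemma gram_det_conformal:
  fixes g :: "'a::euclidean_space metric"
  assumes g: "\<And>p q. g z p q = c * (p \<bullet> q)"
  shows "gram_det g z = c ^ DIM('a)"
proof -
  have 0: "(\<Prod>b\<in>Basis. g z b (p b)) = 0" if p: "p permutes (Basis :: 'a set)" "p \<noteq> id" for p
  proof -
    obtain b where "p b \<noteq> b" using p(2) by (metis eq_id_iff)
    then have b: "b \<in> Basis" using p(1) by (metis permutes_not_in)
    then have "p b \<in> Basis" using p(1) by (simp add: permutes_in_image)
    then have "g z b (p b) = 0" using b \<open>p b \<noteq> b\<close> by (simp add: g inner_Basis)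
    then show ?thesis using b by (meson finite_Basis prod_zero)
  qed
  have "gram_det g z = (\<Sum>p | p permutes (Basis :: 'a set). if p = id then c ^ DIM('a) else 0)"
    unfolding gram_det_def
  proof (rule sum.cong)
    fix p :: "'a \<Rightarrow> 'a" assume "p \<in> {p. p permutes Basis}"
    then show "of_int (sign p) * (\<Prod>b\<in>Basis. g z b (p b)) = (if p = id then c ^ DIM('a) else 0)"
      using 0[of p] by (auto simp: g sign_id prod_constant)
  qed simp
  also have "\<dots> = c ^ DIM('a)"
    by (simp add: sum.delta finite_permutations permutes_id)
  finally show ?thesis .
qed

lemma metric_norm_grad_conformal:
  assumes g: "\<And>p q. g z p q = c * (p \<bullet> q)" and c: "c > 0" and u: "u differentiable (at z)"
  shows "metric_norm g z (grad g u z) = sqrt ((\<Sum>b\<in>Basis. (partial_deriv b u z)\<^sup>2) / c)"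
proof -
  define G where "G = (\<Sum>b\<in>Basis. partial_deriv b u z *\<^sub>R b)"
  have "G \<bullet> G = (\<Sum>b\<in>Basis. (partial_deriv b u z)\<^sup>2)"
    by (subst euclidean_inner) (simp add: G_def power2_eq_square)
  moreover have "grad g u z = (1 / c) *\<^sub>R G"
    unfolding G_def by (rule grad_conformal[of g z c, OF g _ u]) (use c in simp)
  ultimately show ?thesis using c by (simp add: metric_norm_def g)
qed

text \<open>If c = e^(2\<phi>), then \<open>f b\<close> is \<partial>_b \<phi>; prescribing the
  family \<open>f\<close> through its relation to \<open>c\<close> avoids the logarithm.\<close>

lemma christoffel_conformal:
  fixes g :: "'a::euclidean_space metric"
  assumes g: "\<And>z p q. g z p q = c z * (p \<bullet> q)" and c: "c z > 0" and cd: "c differentiable (at z)"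
    and f: "\<And>b. b \<in> Basis \<Longrightarrow> partial_deriv b c z = 2 * c z * f b z"
    and B: "k \<in> Basis" "i \<in> Basis" "j \<in> Basis"
  shows "christoffel g k i j z = (j \<bullet> k) * f i z + (i \<bullet> k) * f j z - (i \<bullet> j) * f k z"
proof -
  have pd: "partial_deriv b (\<lambda>q. g q p r) z = (p \<bullet> r) * (2 * c z * f b z)" if "b \<in> Basis" for b p r
  proof (rule partial_deriv_eqI)
    show "(\<lambda>q. g q p r) differentiable (at z)" unfolding g using cd by simp
    show "((\<lambda>t. g (z + t *\<^sub>R b) p r) has_real_derivative (p \<bullet> r) * (2 * c z * f b z)) (at 0)"
      unfolding g using DERIV_cmult_right[OF differentiable_imp_directional[OF cd, of b], of "p \<bullet> r"] f[OF that]
      by (simp add: mult.commute)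
  qed
  have "christoffel g k i j z = 1 / 2 * (\<Sum>l\<in>Basis. (k \<bullet> l) * ((2 * c z / c z) *
      ((j \<bullet> l) * f i z + (i \<bullet> l) * f j z - (i \<bullet> j) * f l z)))"
    unfolding christoffel_def
  proof (intro arg_cong[where f = "\<lambda>x. 1 / 2 * x"] sum.cong refl)
    fix l :: 'a assume "l \<in> Basis"
    then show "inv_metric g z k l * (partial_deriv i (\<lambda>q. g q j l) z + partial_deriv j (\<lambda>q. g q i l) z
         - partial_deriv l (\<lambda>q. g q i j) z)
      = (k \<bullet> l) * ((2 * c z / c z) * ((j \<bullet> l) * f i z + (i \<bullet> l) * f j z - (i \<bullet> j) * f l z))"
      using c B by (simp add: pd inv_metric_conformal[of g z "c z", OF g] field_simps)
  qed
  then show ?thesis using c unfolding sum_Basis_component[OF B(1)] by simp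
qed

text \<open>The classical formula R = -(N-1) e^(-2\<phi>) (2 \<Delta>\<phi> + (N-2)
  |\<nabla>\<phi>|^2) in dimension N. The inverse metric is diagonal, so only the diagonal of the
  Ricci tensor is computed.\<close>

lemma scalar_curvature_conformal:
  fixes g :: "'a::euclidean_space metric"
  assumes S: "open S" "z \<in> S" and g: "\<And>z p q. g z p q = c z * (p \<bullet> q)"
    and c: "\<And>z. z \<in> S \<Longrightarrow> c z > 0" "\<And>z. z \<in> S \<Longrightarrow> c differentiable (at z)"
    and f: "\<And>b z. b \<in> Basis \<Longrightarrow> z \<in> S \<Longrightarrow> partial_deriv b c z = 2 * c z * f b z"
      "\<And>b z. b \<in> Basis \<Longrightarrow> z \<in> S \<Longrightarrow> f b differentiable (at z)"
  shows "scalar_curvature g z = - (real DIM('a) - 1) / c z *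
     (2 * (\<Sum>b\<in>Basis. partial_deriv b (f b) z) + (real DIM('a) - 2) * (\<Sum>b\<in>Basis. (f b z)\<^sup>2))"
proof -
  let ?N = "real DIM('a)"
  define D where "D = (\<Sum>b\<in>Basis. partial_deriv b (f b) z)"
  define Q where "Q = (\<Sum>b\<in>Basis. (f b z)\<^sup>2)"
  have ch: "christoffel g k i j x = (j \<bullet> k) * f i x + (i \<bullet> k) * f j x - (i \<bullet> j) * f k x"
    if "x \<in> S" "k \<in> Basis" "i \<in> Basis" "j \<in> Basis" for i j k x
    using that by (intro christoffel_conformal[of g c x f] g c f(1))
  note chz = ch[OF S(2)]
  have pch: "partial_deriv l (christoffel g k i j) z
     = (j \<bullet> k) * partial_deriv l (f i) z + (i \<bullet> k) * partial_deriv l (f j) z - (i \<bullet> j) * partial_deriv l (f k) z"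
    if B: "k \<in> Basis" "i \<in> Basis" "j \<in> Basis" for i j k l
  proof -
    define h where "h = (\<lambda>x. (j \<bullet> k) * f i x + (i \<bullet> k) * f j x - (i \<bullet> j) * f k x)"
    have d: "h differentiable (at z)" unfolding h_def using B f(2) S(2) by simp
    have "partial_deriv l (christoffel g k i j) z = partial_deriv l h z"
      by (rule partial_deriv_cong_open[OF S _ d]) (use ch B in \<open>auto simp: h_def\<close>)
    also have "\<dots> = (j \<bullet> k) * partial_deriv l (f i) z + (i \<bullet> k) * partial_deriv l (f j) z - (i \<bullet> j) * partial_deriv l (f k) z"
      unfolding h_def
      by (rule partial_deriv_eqI[OF d[unfolded h_def]])
        (intro DERIV_diff DERIV_add DERIV_cmult differentiable_imp_directional f(2) B S(2))
    finally show ?thesis .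
  qed
  have ric: "ricci g j j z = 2 * partial_deriv j (f j) z - D - ?N * partial_deriv j (f j) z
      + ?N * (2 * (f j z)\<^sup>2 - Q) - (?N * (f j z)\<^sup>2 - 2 * Q + 2 * (f j z)\<^sup>2)" if j: "j \<in> Basis" for j
  proof -
    have A: "partial_deriv i (christoffel g i j j) z - partial_deriv j (christoffel g i i j) z
       = (j \<bullet> i) * (2 * partial_deriv i (f j) z) - partial_deriv i (f i) z - partial_deriv j (f j) z"
      if i: "i \<in> Basis" for i
      using i j by (simp add: pch inner_commute algebra_simps)
    \<comment> \<open>Products of deltas are left unevaluated, squares included, so that the sums
      over \<open>p\<close> and then \<open>i\<close> can each be contracted by
      \<open>sum_Basis_component\<close>.\<close>
    have Bp: "christoffel g i i p z * christoffel g p j j z - christoffel g i j p z * christoffel g p i j z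
       = (j \<bullet> p) * (2 * f j z * f p z) - (f p z)\<^sup>2
         - ((i \<bullet> p) * ((i \<bullet> p) * (f j z)\<^sup>2) - (j \<bullet> i) * ((j \<bullet> i) * (f p z)\<^sup>2)
          - (j \<bullet> p) * ((j \<bullet> p) * (f i z)\<^sup>2) + 2 * ((j \<bullet> p) * ((j \<bullet> i) * (f i z * f p z))))"
      if i: "i \<in> Basis" and p: "p \<in> Basis" for i p
      using i j p by (simp add: chz inner_commute[of i j] inner_commute[of p] power2_eq_square algebra_simps)
    have B: "(\<Sum>p\<in>Basis. christoffel g i i p z * christoffel g p j j z - christoffel g i j p z * christoffel g p i j z)
       = 2 * (f j z)\<^sup>2 - Q - ((f j z)\<^sup>2 - (j \<bullet> i) * ((j \<bullet> i) * Q) - (f i z)\<^sup>2 + 2 * ((j \<bullet> i) * (f i z * f j z)))"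
      if i: "i \<in> Basis" for i
    proof -
      have "(\<Sum>p\<in>Basis. christoffel g i i p z * christoffel g p j j z - christoffel g i j p z * christoffel g p i j z)
        = (\<Sum>p\<in>Basis. (j \<bullet> p) * (2 * f j z * f p z) - (f p z)\<^sup>2
         - ((i \<bullet> p) * ((i \<bullet> p) * (f j z)\<^sup>2) - (j \<bullet> i) * ((j \<bullet> i) * (f p z)\<^sup>2)
          - (j \<bullet> p) * ((j \<bullet> p) * (f i z)\<^sup>2) + 2 * ((j \<bullet> p) * ((j \<bullet> i) * (f i z * f p z)))))"
        by (intro sum.cong refl Bp i)
      also have "\<dots> = 2 * f j z * f j z - Q - ((i \<bullet> i) * (f j z)\<^sup>2 - (j \<bullet> i) * ((j \<bullet> i) * Q)
          - (j \<bullet> j) * (f i z)\<^sup>2 + 2 * ((j \<bullet> i) * (f i z * f j z)))"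
        unfolding sum_subtractf sum.distrib sum_distrib_left[symmetric]
          sum_Basis_component[OF i] sum_Basis_component[OF j] Q_def ..
      finally show ?thesis using i j by (simp add: power2_eq_square)
    qed
    have "ricci g j j z = (\<Sum>i\<in>Basis. (j \<bullet> i) * (2 * partial_deriv i (f j) z) - partial_deriv i (f i) z - partial_deriv j (f j) z
       + (2 * (f j z)\<^sup>2 - Q - ((f j z)\<^sup>2 - (j \<bullet> i) * ((j \<bullet> i) * Q) - (f i z)\<^sup>2 + 2 * ((j \<bullet> i) * (f i z * f j z)))))"
      unfolding ricci_def by (intro sum.cong refl arg_cong2[of _ _ _ _ "(+)"] A B)
    also have "\<dots> = 2 * partial_deriv j (f j) z - D - ?N * partial_deriv j (f j) z
        + (?N * (2 * (f j z)\<^sup>2) - ?N * Q - (?N * (f j z)\<^sup>2 - (j \<bullet> j) * Q - Q + 2 * (f j z * f j z)))"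
      unfolding sum_subtractf sum.distrib sum_distrib_left[symmetric]
        sum_Basis_component[OF j] sum_constant D_def[symmetric] Q_def[symmetric] by (simp only: mult.left_commute)
    finally show ?thesis using j by (simp add: power2_eq_square algebra_simps)
  qed
  have "scalar_curvature g z = (\<Sum>j\<in>Basis. \<Sum>k\<in>Basis. (j \<bullet> k) * (ricci g j k z / c z))"
    unfolding scalar_curvature_def
    using c(1)[OF S(2)] by (simp add: inv_metric_conformal[of g z "c z", OF g])
  also have "\<dots> = (\<Sum>j\<in>Basis. ricci g j j z / c z)"
    by (intro sum.cong refl sum_Basis_component)
  also have "\<dots> = (\<Sum>j\<in>Basis. 2 * partial_deriv j (f j) z - D - ?N * partial_deriv j (f j) z
      + ?N * (2 * (f j z)\<^sup>2 - Q) - (?N * (f j z)\<^sup>2 - 2 * Q + 2 * (f j z)\<^sup>2)) / c z"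
    unfolding sum_divide_distrib[symmetric] using ric by simp
  also have "(\<Sum>j\<in>Basis. 2 * partial_deriv j (f j) z - D - ?N * partial_deriv j (f j) z
      + ?N * (2 * (f j z)\<^sup>2 - Q) - (?N * (f j z)\<^sup>2 - 2 * Q + 2 * (f j z)\<^sup>2))
      = 2 * D - ?N * D - ?N * D + ?N * (2 * Q - ?N * Q) - (?N * Q - ?N * (2 * Q) + 2 * Q)"
    unfolding sum_subtractf sum.distrib sum_distrib_left[symmetric]
      sum_constant D_def[symmetric] Q_def[symmetric] by simp
  finally show ?thesis
    unfolding D_def[symmetric] Q_def[symmetric] by (simp add: field_simps)
qed

section \<open>Positive eigenfunctions on hyperbolic space\<close>

lemma Ck_on_2D:
  assumes "Ck_on 2 v S"
  shows "z \<in> S \<Longrightarrow> v differentiable (at z)"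
    and "z \<in> S \<Longrightarrow> b \<in> Basis \<Longrightarrow> partial_deriv b v differentiable (at z)"
    and "b \<in> Basis \<Longrightarrow> continuous_on S (partial_deriv b (partial_deriv b v))"
    and "continuous_on S v"
    and "b \<in> Basis \<Longrightarrow> continuous_on S (partial_deriv b v)"
  using assms
  by (auto simp: numeral_2_eq_2 intro!: continuous_at_imp_continuous_on differentiable_imp_continuous_within)

lemma differentiable_snd: "snd differentiable (at z)" for z :: "'a::real_normed_vector \<times> 'b::real_normed_vector"
  by (intro bounded_linear_imp_differentiable bounded_linear_snd)

lemma directional_snd:
  "((\<lambda>t. snd (z + t *\<^sub>R b)) has_real_derivative vert \<bullet> b) (at 0)"
  by (auto intro!: derivative_eq_intros simp: vert_inner)

text \<open>The volume density is y^(-n-1) and the gradient is y^2 times the Euclidean one. The flux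
  is therefore y^(1-n) \<partial>_b u, whose exponent produces the first-order coefficient.\<close>

lemma laplace_beltrami_hyperbolic:
  fixes u :: "(real ^ 'n::finite) \<times> real \<Rightarrow> real"
  assumes u: "\<And>z. z \<in> half_space \<Longrightarrow> u differentiable (at z)"
      "\<And>z b. z \<in> half_space \<Longrightarrow> b \<in> Basis \<Longrightarrow> partial_deriv b u differentiable (at z)"
    and z: "z \<in> half_space"
  shows "laplace_beltrami hyperbolic_metric u z =
    (snd z)\<^sup>2 * (\<Sum>b\<in>Basis. partial_deriv b (partial_deriv b u) z)
    + (1 - real CARD('n)) * snd z * partial_deriv vert u z"
proof -
  let ?N = "Suc CARD('n)"
  have g: "hyperbolic_metric q p r = (1 / (snd q)\<^sup>2) * (p \<bullet> r)" for q p r :: "(real ^ 'n) \<times> real"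
    by (simp add: hyperbolic_metric_def)
  have y: "snd q > 0" if "q \<in> half_space" for q :: "(real ^ 'n) \<times> real" using that by (simp add: half_space_def)
  have det: "sqrt (gram_det hyperbolic_metric q) = 1 / snd q ^ ?N" if "q \<in> half_space" for q :: "(real ^ 'n) \<times> real"
  proof -
    have "gram_det hyperbolic_metric q = (1 / (snd q)\<^sup>2) ^ ?N"
      using gram_det_conformal[of hyperbolic_metric q "1 / (snd q)\<^sup>2", OF g] by simp
    also have "\<dots> = (1 / snd q ^ ?N)\<^sup>2"
      by (simp only: power_one_over power_mult[symmetric] mult.commute)
    finally show ?thesis using y[OF that] by (simp add: real_sqrt_abs)
  qed
  have flux: "sqrt (gram_det hyperbolic_metric q) * (grad hyperbolic_metric u q \<bullet> b)
      = (snd q)\<^sup>2 * partial_deriv b u q / snd q ^ ?N" if q: "q \<in> half_space" and b: "b \<in> Basis" for q b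
  proof -
    have "grad hyperbolic_metric u q \<bullet> b = (snd q)\<^sup>2 * partial_deriv b u q"
      using b y[OF q] by (subst grad_conformal[of hyperbolic_metric q "1 / (snd q)\<^sup>2", OF g _ u(1)[OF q]]) auto
    then show ?thesis by (simp add: det[OF q])
  qed
  have pd: "partial_deriv b (\<lambda>q. sqrt (gram_det hyperbolic_metric q) * (grad hyperbolic_metric u q \<bullet> b)) z
     = ((snd z)\<^sup>2 * partial_deriv b (partial_deriv b u) z
         + (vert \<bullet> b) * ((1 - real CARD('n)) * snd z * partial_deriv b u z)) / snd z ^ ?N"
    if b: "b \<in> Basis" for b
  proof -
    define h where "h = (\<lambda>q. (snd q)\<^sup>2 * partial_deriv b u q / snd q ^ ?N)"
    have d: "h differentiable (at z)"
      unfolding h_def using y[OF z] u(2)[OF z b]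
      by (intro differentiable_divide differentiable_mult differentiable_power differentiable_snd) auto
    have "partial_deriv b (\<lambda>q. sqrt (gram_det hyperbolic_metric q) * (grad hyperbolic_metric u q \<bullet> b)) z
      = partial_deriv b h z"
      by (rule partial_deriv_cong_open[OF open_half_space z _ d]) (simp add: flux[OF _ b] h_def)
    also have "\<dots> = ((snd z)\<^sup>2 * partial_deriv b (partial_deriv b u) z
         + (vert \<bullet> b) * ((1 - real CARD('n)) * snd z * partial_deriv b u z)) / snd z ^ ?N"
      by (rule partial_deriv_eqI[OF d], unfold h_def,
         (rule derivative_eq_intros directional_snd differentiable_imp_directional[OF u(2)[OF z b]] refl)+)
        (use y[OF z] in \<open>simp_all add: field_simps power2_eq_square\<close>)
    finally show ?thesis .
  qed
  have "laplace_beltrami hyperbolic_metric u z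
    = (\<Sum>b\<in>Basis. (snd z)\<^sup>2 * partial_deriv b (partial_deriv b u) z
         + (vert \<bullet> b) * ((1 - real CARD('n)) * snd z * partial_deriv b u z)) / snd z ^ ?N / (1 / snd z ^ ?N)"
    unfolding laplace_beltrami_def det[OF z] sum_divide_distrib[where A = Basis] using pd by simp
  also have "\<dots> = (\<Sum>b\<in>Basis. (snd z)\<^sup>2 * partial_deriv b (partial_deriv b u) z
         + (vert \<bullet> b) * ((1 - real CARD('n)) * snd z * partial_deriv b u z))"
    using y[OF z] by simp
  finally show ?thesis
    unfolding sum.distrib sum_distrib_left[symmetric] sum_Basis_component[OF vert_Basis] .
qed

locale hyperbolic_eigenfunction =
  fixes v :: "(real ^ 'n::finite) \<times> real \<Rightarrow> real" and m s :: real
  assumes m: "m = real CARD('n) - s" "m > 0"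
    and v2: "Ck_on 2 v half_space"
    and vpos: "\<And>z. z \<in> half_space \<Longrightarrow> v z > 0"
    and veq: "\<And>z. z \<in> half_space \<Longrightarrow> - laplace_beltrami hyperbolic_metric v z - s * m * v z = 0"
begin

abbreviation "D1 \<equiv> \<lambda>b. partial_deriv b v"
abbreviation "D2 \<equiv> \<lambda>b. partial_deriv b (partial_deriv b v)"

definition "\<rho> = (\<lambda>z. v z powr (1 / m))"
definition "gs = (\<lambda>z p q. (\<rho> z)\<^sup>2 * hyperbolic_metric z p q)"

lemmas vd = Ck_on_2D[OF v2]

lemma euclidean_equation:
  assumes z: "z \<in> half_space"
  shows "(snd z)\<^sup>2 * (\<Sum>b\<in>Basis. D2 b z) + (1 - real CARD('n)) * snd z * D1 vert z + s * m * v z = 0"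
  using veq[OF z] laplace_beltrami_hyperbolic[OF vd(1,2) z] by simp

lemma directional_v:
  assumes "z \<in> half_space"
  shows "((\<lambda>t. v (z + t *\<^sub>R b)) has_real_derivative D1 b z) (at 0)"
    and "b \<in> Basis \<Longrightarrow> ((\<lambda>t. D1 b (z + t *\<^sub>R b)) has_real_derivative D2 b z) (at 0)"
  by (rule differentiable_imp_directional, rule vd, rule assms, assumption?)+

lemma \<rho>_differentiable:
  assumes z: "z \<in> half_space"
  shows "\<rho> differentiable (at z)" and "partial_deriv b \<rho> z = \<rho> z * (D1 b z / (m * v z))"
proof -
  obtain v' where "(v has_derivative v') (at z)" using vd(1)[OF z] by (auto simp: differentiable_def)
  from has_derivative_powr[OF this has_derivative_const[of "1 / m"] vpos[OF z]]
  show d: "\<rho> differentiable (at z)" unfolding \<rho>_def differentiable_def by blast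
  have "((\<lambda>t. v (z + t *\<^sub>R b) powr (1 / m)) has_real_derivative
      1 / m * v (z + 0 *\<^sub>R b) powr (1 / m - of_nat 1) * D1 b z) (at 0)"
    using vpos[OF z] by (intro DERIV_fun_powr directional_v z) auto
  then have "((\<lambda>t. \<rho> (z + t *\<^sub>R b)) has_real_derivative \<rho> z * (D1 b z / (m * v z))) (at 0)"
    unfolding \<rho>_def using vpos[OF z] by (simp add: powr_diff field_simps)
  then show "partial_deriv b \<rho> z = \<rho> z * (D1 b z / (m * v z))" by (rule partial_deriv_eqI[OF d])
qed

lemma \<rho>_pos: "z \<in> half_space \<Longrightarrow> \<rho> z > 0"
  using vpos[of z] by (simp add: \<rho>_def)

lemma gs_conformal: "gs z p q = ((\<rho> z)\<^sup>2 / (snd z)\<^sup>2) * (p \<bullet> q)"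
  by (simp add: gs_def hyperbolic_metric_def)

text \<open>The factor \<rho> cancels because \<nabla>\<rho> / \<rho> = \<nabla>v / (m v), which
  makes the gradient condition a bound on the logarithmic gradient of \<open>v\<close>.\<close>

lemma metric_norm_grad_\<rho>:
  assumes z: "z \<in> half_space"
  shows "metric_norm gs z (grad gs \<rho> z) = snd z / (m * v z) * sqrt (\<Sum>b\<in>Basis. (D1 b z)\<^sup>2)"
proof -
  have pos: "snd z > 0" "v z > 0" "\<rho> z > 0" using z vpos \<rho>_pos by (auto simp: half_space_def)
  have "metric_norm gs z (grad gs \<rho> z) = sqrt ((\<Sum>b\<in>Basis. (partial_deriv b \<rho> z)\<^sup>2) / ((\<rho> z)\<^sup>2 / (snd z)\<^sup>2))"
    by (rule metric_norm_grad_conformal[OF gs_conformal _ \<rho>_differentiable(1)[OF z]]) (use pos in simp)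
  also have "(\<Sum>b\<in>Basis. (partial_deriv b \<rho> z)\<^sup>2) = (\<rho> z / (m * v z))\<^sup>2 * (\<Sum>b\<in>Basis. (D1 b z)\<^sup>2)"
    unfolding sum_distrib_left
    by (intro sum.cong refl) (simp add: \<rho>_differentiable(2)[OF z] power_mult_distrib power_divide)
  also have "(\<rho> z / (m * v z))\<^sup>2 * (\<Sum>b\<in>Basis. (D1 b z)\<^sup>2) / ((\<rho> z)\<^sup>2 / (snd z)\<^sup>2)
      = (snd z / (m * v z))\<^sup>2 * (\<Sum>b\<in>Basis. (D1 b z)\<^sup>2)"
    using pos by (simp add: field_simps power2_eq_square)
  finally show ?thesis using pos m by (simp add: real_sqrt_mult)
qed

text \<open>The conformal curvature formula for \<phi> = log (\<rho>/y), with the Laplacian of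
  \<open>v\<close> eliminated by the eigenvalue equation. The terms with the vertical derivative of
  \<open>v\<close> then cancel.\<close>

lemma scalar_curvature_gs:
  assumes z: "z \<in> half_space"
  shows "scalar_curvature gs z = 2 * real CARD('n) * (s - (real CARD('n) + 1) / 2)
    * (1 - (metric_norm gs z (grad gs \<rho> z))\<^sup>2) / (\<rho> z)\<^sup>2"
proof -
  define c where "c = (\<lambda>z. (\<rho> z)\<^sup>2 / (snd z)\<^sup>2)"
  \<comment> \<open>The partial derivatives of log (\<rho>/y).\<close>
  define f where "f = (\<lambda>b z. D1 b z / (m * v z) - (vert \<bullet> b) / snd z)"
  have y: "snd q > 0" if "q \<in> half_space" for q :: "(real ^ 'n) \<times> real" using that by (simp add: half_space_def)
  have g: "gs z p q = c z * (p \<bullet> q)" for z p q unfolding c_def by (rule gs_conformal)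
  have cpos: "c q > 0" if "q \<in> half_space" for q using y[OF that] \<rho>_pos[OF that] by (simp add: c_def)
  have cd: "c differentiable (at q)" if q: "q \<in> half_space" for q
    unfolding c_def using y[OF q]
    by (intro differentiable_divide differentiable_power differentiable_snd \<rho>_differentiable(1)[OF q]) auto
  have cf: "partial_deriv b c q = 2 * c q * f b q" if q: "q \<in> half_space" for b q
  proof (rule partial_deriv_eqI[OF cd[OF q]])
    have r: "((\<lambda>t. \<rho> (q + t *\<^sub>R b)) has_real_derivative \<rho> q * (D1 b q / (m * v q))) (at 0)"
      using differentiable_imp_directional[OF \<rho>_differentiable(1)[OF q]] \<rho>_differentiable(2)[OF q] by simp
    show "((\<lambda>t. c (q + t *\<^sub>R b)) has_real_derivative 2 * c q * f b q) (at 0)"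
      unfolding c_def
      by (rule derivative_eq_intros directional_snd r refl)+
        (use y[OF q] vpos[OF q] m in \<open>simp_all add: f_def field_simps power2_eq_square\<close>)
  qed
  have fd: "f b differentiable (at q)" if q: "q \<in> half_space" and b: "b \<in> Basis" for b q
    unfolding f_def using y[OF q] vpos[OF q] m vd(1)[OF q] vd(2)[OF q b]
    by (intro differentiable_diff differentiable_divide differentiable_mult differentiable_const differentiable_snd) auto
  have ff: "partial_deriv b (f b) z = D2 b z / (m * v z) - (D1 b z)\<^sup>2 / (m * (v z)\<^sup>2) + (vert \<bullet> b) * ((vert \<bullet> b) / (snd z)\<^sup>2)"
    if b: "b \<in> Basis" for b
  proof (rule partial_deriv_eqI[OF fd[OF z b]])
    show "((\<lambda>t. f b (z + t *\<^sub>R b)) has_real_derivative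
        D2 b z / (m * v z) - (D1 b z)\<^sup>2 / (m * (v z)\<^sup>2) + (vert \<bullet> b) * ((vert \<bullet> b) / (snd z)\<^sup>2)) (at 0)"
      unfolding f_def
      using DERIV_diff[OF DERIV_divide[OF directional_v(2)[OF z b] DERIV_cmult[OF directional_v(1)[OF z, of b], of m]]
          DERIV_divide[OF DERIV_const[of "vert \<bullet> b"] directional_snd[of z b]]] y[OF z] vpos[OF z] m(2)
      by (auto elim!: DERIV_cong simp: field_simps power2_eq_square)
  qed
  define \<Delta> where "\<Delta> = (\<Sum>b\<in>Basis. D2 b z)"
  define Q where "Q = (\<Sum>b\<in>Basis. (D1 b z)\<^sup>2)"
  have sumF: "(\<Sum>b\<in>Basis. partial_deriv b (f b) z) = \<Delta> / (m * v z) - Q / (m * (v z)\<^sup>2) + 1 / (snd z)\<^sup>2"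
  proof -
    have "(\<Sum>b\<in>Basis. partial_deriv b (f b) z) = (\<Sum>b\<in>Basis. D2 b z / (m * v z) - (D1 b z)\<^sup>2 / (m * (v z)\<^sup>2) + (vert \<bullet> b) * ((vert \<bullet> b) / (snd z)\<^sup>2))"
      by (intro sum.cong refl ff)
    then show ?thesis
      unfolding sum.distrib sum_subtractf sum_Basis_component[OF vert_Basis] sum_divide_distrib[symmetric] \<Delta>_def Q_def
      by (simp add: vert_inner)
  qed
  have sumf: "(\<Sum>b\<in>Basis. (f b z)\<^sup>2) = Q / (m * v z)\<^sup>2 - 2 * D1 vert z / (m * v z * snd z) + 1 / (snd z)\<^sup>2"
  proof -
    have "(f b z)\<^sup>2 = (D1 b z)\<^sup>2 / (m * v z)\<^sup>2 - (vert \<bullet> b) * (2 * D1 b z / (m * v z * snd z)) + (vert \<bullet> b) * ((vert \<bullet> b) / (snd z)\<^sup>2)" for b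
      unfolding f_def power2_diff power_divide by (simp add: power2_eq_square)
    then have "(\<Sum>b\<in>Basis. (f b z)\<^sup>2) = (\<Sum>b\<in>Basis. (D1 b z)\<^sup>2 / (m * v z)\<^sup>2 - (vert \<bullet> b) * (2 * D1 b z / (m * v z * snd z)) + (vert \<bullet> b) * ((vert \<bullet> b) / (snd z)\<^sup>2))"
      by simp
    then show ?thesis
      unfolding sum.distrib sum_subtractf sum_Basis_component[OF vert_Basis] sum_divide_distrib[symmetric] Q_def
      by (simp add: vert_inner)
  qed
  define n where "n = real CARD('n)"
  define y where "y = snd z"
  define V where "V = v z"
  have pos: "y > 0" "V > 0" "\<rho> z > 0" using y[OF z] vpos[OF z] \<rho>_pos[OF z] by (auto simp: y_def V_def)
  have \<Delta>: "\<Delta> = ((n - 1) * y * D1 vert z - s * m * V) / y\<^sup>2"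
    using euclidean_equation[OF z] pos by (simp add: \<Delta>_def n_def y_def V_def field_simps)
  have norm2: "(metric_norm gs z (grad gs \<rho> z))\<^sup>2 = (y / (m * V))\<^sup>2 * Q"
    unfolding metric_norm_grad_\<rho>[OF z] power_mult_distrib y_def V_def Q_def
    by (simp add: sum_nonneg)
  have "scalar_curvature gs z = - n / c z * (2 * (\<Delta> / (m * V) - Q / (m * V\<^sup>2) + 1 / y\<^sup>2)
      + (n - 1) * (Q / (m * V)\<^sup>2 - 2 * D1 vert z / (m * V * y) + 1 / y\<^sup>2))"
    using scalar_curvature_conformal[where S = half_space and z = z and c = c and f = f and g = gs, OF open_half_space z g cpos cd cf fd]
    unfolding sumF sumf by (simp add: n_def y_def V_def)
  also have "2 * (\<Delta> / (m * V) - Q / (m * V\<^sup>2) + 1 / y\<^sup>2)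
      + (n - 1) * (Q / (m * V)\<^sup>2 - 2 * D1 vert z / (m * V * y) + 1 / y\<^sup>2)
      = (n + 1 - 2 * s) * (1 / y\<^sup>2 - Q / (m * V)\<^sup>2)"
  proof -
    \<comment> \<open>This relation gives both the constant and the quadratic term the common factor
      n + 1 - 2 s.\<close>
    have n: "n = m + s" using m by (simp add: n_def)
    show ?thesis unfolding \<Delta> n using pos m(2)
      by (simp add: field_simps power2_eq_square)
  qed
  also have "- n / c z * ((n + 1 - 2 * s) * (1 / y\<^sup>2 - Q / (m * V)\<^sup>2))
     = 2 * n * (s - (n + 1) / 2) * (1 - (y / (m * V))\<^sup>2 * Q) / (\<rho> z)\<^sup>2"
    unfolding c_def y_def[symmetric] using pos m(2) by (simp add: field_simps power2_eq_square)
  finally show ?thesis unfolding norm2 n_def .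
qed

end

section \<open>From the eigenfunction to the weighted equation, and the equivalent
  conditions\<close>

context hyperbolic_eigenfunction
begin

definition "w = (\<lambda>z. 1 - v z / snd z powr m)"

definition "W1 = (\<lambda>b z. snd z powr (- m) * (m * v z * (vert \<bullet> b) / snd z - D1 b z))"

definition "W2 = (\<lambda>b z. snd z powr (- m) * ((vert \<bullet> b) * (2 * m * D1 b z / snd z)
    - (vert \<bullet> b) * ((vert \<bullet> b) * (m * (m + 1) * v z / (snd z)\<^sup>2)) - D2 b z))"

text \<open>Since 2 m = n - 2\<gamma>, the coefficient 1 - 2\<gamma> - 2 m of the vertical
  derivative is 1 - n, and m + 2\<gamma> is s. Up to a power of y and a sign the weighted equation
  is thus the eigenvalue equation.\<close>

lemma weighted_harmonic_w:
  assumes \<gamma>: "0 < \<gamma>" "\<gamma> < 1" "s = real CARD('n) / 2 + \<gamma>" and trace: "w \<in> H1_tilde (1 - 2 * \<gamma>)"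
  shows "weighted_harmonic w W1 W2 \<gamma>"
proof
  have y: "snd z > 0" if "z \<in> half_space" for z :: "(real ^ 'n) \<times> real" using that by (simp add: half_space_def)
  have sc: "continuous_on half_space (\<lambda>z::(real ^ 'n) \<times> real. snd z powr c)" for c
    by (intro continuous_on_powr continuous_intros) (use y in force)
  have w_eq: "w = (\<lambda>z. 1 - v z * snd z powr (- m))"
    by (simp add: w_def powr_minus_divide)
  show "continuous_on half_space w"
    unfolding w_eq by (intro continuous_intros sc vd(4))
  show "continuous_on half_space (W1 b)" if "b \<in> Basis" for b
    unfolding W1_def using y by (intro continuous_intros sc vd(4) vd(5)[OF that]) force
  show "continuous_on half_space (W2 b)" if "b \<in> Basis" for b
    unfolding W2_def using y by (intro continuous_intros sc vd(4) vd(5,3)[OF that]) force+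
  have dp: "((\<lambda>t. snd (z + t *\<^sub>R b) powr (- m)) has_real_derivative
      - (m * snd z powr (- m) * (vert \<bullet> b) / snd z)) (at 0)" if z: "z \<in> half_space" for z b :: "(real ^ 'n) \<times> real"
    using DERIV_fun_powr[OF directional_snd[of z b], of "- m"] y[OF z]
    by (simp add: powr_diff)
  show "((\<lambda>t. w (z + t *\<^sub>R b)) has_real_derivative W1 b z) (at 0)"
    if z: "z \<in> half_space" and b: "b \<in> Basis" for z b
    unfolding w_eq using DERIV_diff[OF DERIV_const[of 1] DERIV_mult[OF directional_v(1)[OF z] dp[OF z]], of b b] 
    by (rule DERIV_cong) (simp add: W1_def algebra_simps)
  show "((\<lambda>t. W1 b (z + t *\<^sub>R b)) has_real_derivative W2 b z) (at 0)"
    if z: "z \<in> half_space" and b: "b \<in> Basis" for z b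
    unfolding W1_def
    by (rule DERIV_cong[OF DERIV_mult[OF dp[OF z, of b] DERIV_diff[OF DERIV_divide[OF DERIV_cmult_right[OF DERIV_cmult[OF directional_v(1)[OF z, of b], of m], of "vert \<bullet> b"] directional_snd[of z b]] directional_v(2)[OF z b]]]])
      (use y[OF z] in \<open>simp_all add: W2_def field_simps power2_eq_square\<close>)
  show "snd z * (\<Sum>b\<in>Basis. W2 b z) + (1 - 2 * \<gamma>) * W1 vert z = 0" if z: "z \<in> half_space" for z
  proof -
    define \<Delta> where "\<Delta> = (\<Sum>b\<in>Basis. D2 b z)"
    have S: "(\<Sum>b\<in>Basis. W2 b z) = snd z powr (- m) * (2 * m * D1 vert z / snd z - m * (m + 1) * v z / (snd z)\<^sup>2 - \<Delta>)"
      unfolding W2_def sum_distrib_left[symmetric] sum_subtractf sum_Basis_component[OF vert_Basis] \<Delta>_def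
      by (simp add: vert_inner)
    have m': "2 * m = real CARD('n) - 2 * \<gamma>" using m \<gamma> by simp
    have "snd z * (snd z * (\<Sum>b\<in>Basis. W2 b z) + (1 - 2 * \<gamma>) * W1 vert z)
       = - (snd z powr (- m)) * ((snd z)\<^sup>2 * \<Delta> + (1 - 2 * \<gamma> - 2 * m) * snd z * D1 vert z + (m + 2 * \<gamma>) * m * v z)"
      unfolding S W1_def using y[OF z] by (simp add: vert_inner field_simps power2_eq_square)
    also have "(snd z)\<^sup>2 * \<Delta> + (1 - 2 * \<gamma> - 2 * m) * snd z * D1 vert z + (m + 2 * \<gamma>) * m * v z
       = (snd z)\<^sup>2 * \<Delta> + (1 - real CARD('n)) * snd z * D1 vert z + s * m * v z"
      using m \<gamma>(3) by simp
    also have "\<dots> = 0" unfolding \<Delta>_def by (rule euclidean_equation[OF z])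
    finally show ?thesis using y[OF z] by simp
  qed
qed (use \<gamma> trace in auto)

text \<open>Only the vertical component of the gradient is kept: the bound gives \<partial>_y v
  \<le> m v / y, which says that v / y^m does not increase in y.\<close>

lemma gradient_bound_imp_W1_nonneg:
  assumes z: "z \<in> half_space" and 1: "metric_norm gs z (grad gs \<rho> z) \<le> 1"
  shows "0 \<le> W1 vert z"
proof -
  have pos: "snd z > 0" "v z > 0" using z vpos by (auto simp: half_space_def)
  have "(D1 vert z)\<^sup>2 \<le> (\<Sum>b\<in>Basis. (D1 b z)\<^sup>2)"
    by (rule member_le_sum[OF vert_Basis]) auto
  then have "D1 vert z \<le> sqrt (\<Sum>b\<in>Basis. (D1 b z)\<^sup>2)" by (rule real_le_rsqrt)
  also have "\<dots> \<le> m * v z / snd z"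
    using 1 pos m(2) unfolding metric_norm_grad_\<rho>[OF z] by (simp add: field_simps)
  finally show ?thesis by (simp add: W1_def vert_inner)
qed

lemma liouville:
  assumes \<gamma>: "0 < \<gamma>" "\<gamma> < 1" "s = real CARD('n) / 2 + \<gamma>" and trace: "w \<in> H1_tilde (1 - 2 * \<gamma>)"
    and grad: "\<And>z. z \<in> half_space \<Longrightarrow> metric_norm gs z (grad gs \<rho> z) \<le> 1"
    and z: "z \<in> half_space"
  shows "v z = snd z powr m"
proof -
  interpret weighted_harmonic w W1 W2 \<gamma> by (rule weighted_harmonic_w[OF \<gamma> trace])
  have "w z = 0"
  proof (rule bounded_nonneg_eq_0[OF _ _ z])
    fix x :: "(real ^ 'n) \<times> real" assume x: "x \<in> half_space"
    show "0 \<le> w x"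
      by (rule vertically_monotone_nonneg[OF _ x]) (intro gradient_bound_imp_W1_nonneg grad)
    show "w x \<le> 1" using vpos[OF x] by (simp add: w_def)
  qed
  then show ?thesis using z by (simp add: w_def half_space_def)
qed

lemma gs_euclidean_iff:
  "(\<forall>z\<in>half_space. v z = snd z powr m) \<longleftrightarrow> (\<forall>z\<in>half_space. \<forall>p q. gs z p q = p \<bullet> q)"
proof
  assume L: "\<forall>z\<in>half_space. v z = snd z powr m"
  show "\<forall>z\<in>half_space. \<forall>p q. gs z p q = p \<bullet> q"
  proof (intro ballI allI)
    fix z p q :: "(real ^ 'n) \<times> real" assume z: "z \<in> half_space"
    then have y: "snd z > 0" by (simp add: half_space_def)
    have "\<rho> z = snd z" using L z y m(2) by (simp add: \<rho>_def powr_powr)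
    then show "gs z p q = p \<bullet> q" using y by (simp add: gs_conformal)
  qed
next
  assume R: "\<forall>z\<in>half_space. \<forall>p q. gs z p q = p \<bullet> q"
  show "\<forall>z\<in>half_space. v z = snd z powr m"
  proof
    fix z :: "(real ^ 'n) \<times> real" assume z: "z \<in> half_space"
    then have y: "snd z > 0" by (simp add: half_space_def)
    \<comment> \<open>One diagonal entry already determines the conformal factor.\<close>
    have "gs z vert vert = vert \<bullet> (vert :: (real ^ 'n) \<times> real)" using R z by blast
    then have "(\<rho> z)\<^sup>2 = (snd z)\<^sup>2" using y by (simp add: gs_conformal vert_inner)
    then have "\<rho> z = snd z" using y \<rho>_pos[OF z] by (simp add: power2_eq_iff)
    then have "snd z powr m = (v z powr (1 / m)) powr m" by (simp add: \<rho>_def)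
    then show "v z = snd z powr m" using m(2) vpos[OF z] by (simp add: powr_powr)
  qed
qed

lemma gradient_bound_iff_sgn_scalar_curvature:
  assumes \<gamma>: "s = real CARD('n) / 2 + \<gamma>" "\<gamma> \<noteq> 1 / 2" and z: "z \<in> half_space"
  shows "metric_norm gs z (grad gs \<rho> z) \<le> 1 \<longleftrightarrow>
    scalar_curvature gs z = 0 \<or> sgn (scalar_curvature gs z) = sgn (\<gamma> - 1 / 2)"
proof -
  define M where "M = metric_norm gs z (grad gs \<rho> z)"
  have pos: "snd z > 0" "v z > 0" using z vpos by (auto simp: half_space_def)
  have M: "M \<ge> 0" unfolding M_def metric_norm_grad_\<rho>[OF z] using pos m(2) by (simp add: sum_nonneg)
  define A where "A = 2 * real CARD('n) / (\<rho> z)\<^sup>2"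
  have A: "A > 0" using \<rho>_pos[OF z] by (simp add: A_def)
  have R: "scalar_curvature gs z = A * ((\<gamma> - 1 / 2) * (1 - M\<^sup>2))"
  proof -
    have "s - (real CARD('n) + 1) / 2 = \<gamma> - 1 / 2" using \<gamma>(1) by (simp add: field_simps)
    then show ?thesis unfolding scalar_curvature_gs[OF z] M_def[symmetric] A_def by simp
  qed
  have "M \<le> 1 \<longleftrightarrow> 0 \<le> 1 - M\<^sup>2" using M by (simp add: abs_square_le_1)
  also have "\<dots> \<longleftrightarrow> 1 - M\<^sup>2 = 0 \<or> sgn (\<gamma> - 1 / 2) * sgn (1 - M\<^sup>2) = sgn (\<gamma> - 1 / 2)"
    using \<gamma>(2) by (auto simp: sgn_if)
  also have "\<dots> \<longleftrightarrow> scalar_curvature gs z = 0 \<or> sgn (scalar_curvature gs z) = sgn (\<gamma> - 1 / 2)"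
    unfolding R sgn_mult using A \<gamma>(2) by simp
  finally show ?thesis unfolding M_def .
qed

end

theorem theorem1p2:
  fixes n :: nat
    and \<gamma> s a :: real
    and v w \<rho> :: "(real ^ 'n::finite) \<times> real \<Rightarrow> real"
    and gs :: "((real ^ 'n) \<times> real) metric"
  assumes "n = CARD('n)"
    and "0 < \<gamma>" and "\<gamma> < 1"
    and "s = real n / 2 + \<gamma>" and "real n / 2 < s" and "s < real n"
    and "a = 1 - 2 * \<gamma>"
    and "Ck_on 2 v half_space"
    and "\<forall>z\<in>half_space. v z > 0"
    and "\<forall>z\<in>half_space. - laplace_beltrami hyperbolic_metric v z - s * (real n - s) * v z = 0"
    and "w = (\<lambda>z. 1 - v z / snd z powr (real n - s))"
    and "\<rho> = (\<lambda>z. v z powr (1 / (real n - s)))"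
    and "gs = (\<lambda>z p q. (\<rho> z)\<^sup>2 * hyperbolic_metric z p q)"
  shows
    "(w \<in> H1_tilde a \<and> (\<forall>z\<in>half_space. metric_norm gs z (grad gs \<rho> z) \<le> 1)
        \<longrightarrow> (\<forall>z\<in>half_space. v z = snd z powr (real n - s)))
     \<and> ((\<forall>z\<in>half_space. v z = snd z powr (real n - s))
        \<longleftrightarrow> (\<forall>z\<in>half_space. \<forall>p q. gs z p q = p \<bullet> q))
     \<and> (\<gamma> \<noteq> 1/2 \<longrightarrow>
        ((\<forall>z\<in>half_space. metric_norm gs z (grad gs \<rho> z) \<le> 1)
         \<longleftrightarrow> (\<forall>z\<in>half_space. scalar_curvature gs z = 0
                \<or> sgn (scalar_curvature gs z) = sgn (\<gamma> - 1/2))))"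
proof -
  define m where "m = real n - s"
  have m: "m = real CARD('n) - s" "m > 0" using assms by (simp_all add: m_def)
  interpret E: hyperbolic_eigenfunction v m s
    using m assms by unfold_locales (auto simp: m_def)
  have w: "w = E.w" by (simp only: assms(11) m_def[symmetric] E.w_def)
  have \<rho>: "\<rho> = E.\<rho>" by (simp only: assms(12) m_def[symmetric] E.\<rho>_def)
  have gs: "gs = E.gs" by (simp only: assms(13) \<rho> E.gs_def)
  have s: "s = real CARD('n) / 2 + \<gamma>" using assms by simp
  show ?thesis
    unfolding w gs \<rho> \<open>a = 1 - 2 * \<gamma>\<close> m_def[symmetric]
    using E.liouville[OF \<open>0 < \<gamma>\<close> \<open>\<gamma> < 1\<close> s] E.gs_euclidean_iff
      E.gradient_bound_iff_sgn_scalar_curvature[OF s] by blast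
qed

end
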